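(* Let $H\colon\mathbb{R}^3\to\mathbb{R}$ be a $C^1$ mapping such that, for some $A\in C^1(\mathbb{S}^2)$, $\beta>1$ and $\nu>0$, $$H(X)=1+\frac{A(X/|X|)}{|X|^{\beta}}+O\left(\frac{1}{|X|^{\beta+\nu}}\right)\quad\text{as }|X|\to\infty,\ X\in\mathbb{R}^3 ,$$ and $\limsup_{|X|\to\infty}|X|^{\beta+1}|\nabla H(X)|<\infty$. Then there cannot exist $\alpha\in(0,1]$ and sequences $(a_k)_k\subset\mathbb{R}\setminus\{0\}$, $(n_k)_k\subset\mathbb{N}$ and $(\varphi_k)_k\subset C^{2,\alpha}(\mathbb{R}^2)$ such that: (i) $a_k\to 0$ and $n_k\to\infty$ as $k\to\infty$; (ii) $\varphi_k=\varphi_k(t,\theta)$ is doubly periodic, of period $2n_k\tau_{a_k}$ with respect to $t$ and of period $2\pi$ with respect to $\theta$, and satisfies $$\|\varphi_k\|_{C^2(K_{n_k,a_k};x_{a_k}^{-1})}\le\frac{R_1}{n_k},\qquad [D^2\varphi_k]_{\alpha,K_{n_k,a_k}}\le\frac{R}{n_k}$$ for some constants $R_1\in\left(0,\frac{\pi}{2+\sqrt2}\right)$ and $R>0$, both independent of $k$; (iii) the surface parameterized by $X_{n_k,a_k}+\varphi_kN_{n_k,a_k}$ has mean curvature $H(X_{n_k,a_k}+\varphi_kN_{n_k,a_k})$ (at every point).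
   Context: Delaunay functions. For $a\in[-\frac12,\infty)\setminus\{0\}$ let $\gamma_a=a(1+a)$ and let $x_a,z_a\colon\mathbb{R}\to\mathbb{R}$ solve $$x_a''=(1+2\gamma_a)x_a-2x_a^3,\ x_a(0)=1+a,\ x_a'(0)=0;\qquad z_a'=x_a^2-\gamma_a,\ z_a(0)=0.$$ The function $x_a$ is positive and even, with $|a|\le x_a\le 1+a$, and periodic; $2\tau_a>0$ denotes its (minimal, for $a>-\frac12$) period, and $h_a>0$ is the number such that $z_a(t+2\tau_a)=2h_a+z_a(t)$ for all $t$ (for $a=-\frac12$, where $x_a\equiv\frac12$, one sets $\tau_a=\pi$, $h_a=\frac{\pi}{2}$). These objects are defined only for $a\ge-\frac12$, so the $a_k$ are understood to lie in $[-\frac12,\infty)\setminus\{0\}$. Delaunay tori. For $n\in\mathbb{N}$ (sufficiently large) set $$X_{n,a}(t,\theta)=\begin{pmatrix}x_a(t)\cos\theta\\ \left(\frac{nh_a}{\pi}+x_a(t)\sin\theta\right)\cos\frac{\pi z_a(t)}{nh_a}\\ \left(\frac{nh_a}{\pi}+x_a(t)\sin\theta\right)\sin\frac{\pi z_a(t)}{nh_a}\end{pmatrix},\qquad N_{n,a}=\frac{\partial_tX_{n,a}\wedge\partial_\theta X_{n,a}}{|\partial_tX_{n,a}\wedge\partial_\theta X_{n,a}|},$$ and $K_{n,a}=[-n\tau_a,n\tau_a]\times[-\pi,\pi]$. Here $\wedge$ is the cross product in $\mathbb{R}^3$. Norms. $\|\varphi\|_{C^2(K_{n,a};x_a^{-1})}=\sup_{(t,\theta)\in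 K_{n,a}}x_a(t)^{-1}\left(|\varphi|+|\nabla\varphi|+|D^2\varphi|\right)(t,\theta)$, where $|\cdot|$ is the Euclidean norm of vectors and matrices (for the Hessian $D^2\varphi$: square root of the sum of the squared entries). $[F]_{\alpha,K}$ is the Hölder constant of $F$ on $K$ with exponent $\alpha$. Mean curvature. For a regular parametric surface $X=X(t,\theta)$ with normal $N=\frac{X_t\wedge X_\theta}{|X_t\wedge X_\theta|}$, the mean curvature is $\mathfrak{M}(X)=\frac{\mathcal{E}\mathcal{N}-2\mathcal{F}\mathcal{M}+\mathcal{G}\mathcal{L}}{2(\mathcal{E}\mathcal{G}-\mathcal{F}^2)}$ with $\mathcal{E}=|X_t|^2$, $\mathcal{F}=X_t\cdot X_\theta$, $\mathcal{G}=|X_\theta|^2$, $\mathcal{L}=X_{tt}\cdot N$, $\mathcal{M}=X_{t\theta}\cdot N$, $\mathcal{N}=X_{\theta\theta}\cdot N$. *)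

theory Defs
  imports "HOL-Analysis.Analysis" "HOL-Library.Landau_Symbols"
begin

definition grad :: "('a::real_inner \<Rightarrow> real) \<Rightarrow> 'a \<Rightarrow> 'a" where
  "grad f x = (THE g. GDERIV f x :> g)"

definition C1_on :: "'a::euclidean_space set \<Rightarrow> ('a \<Rightarrow> real) \<Rightarrow> bool" where
  "C1_on U f \<longleftrightarrow> (\<forall>x\<in>U. f differentiable (at x)) \<and> continuous_on U (grad f)"

text \<open>
  \<open>A \<in> C\<^sup>1(S\<^sup>2)\<close>: restriction to the unit sphere of a \<open>C\<^sup>1\<close> function defined near it.
  Only the values of \<open>A\<close> on the sphere matter.
\<close>

definition C1_sphere :: "(real^3 \<Rightarrow> real) \<Rightarrow> bool" where
  "C1_sphere A \<longleftrightarrow>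
     (\<exists>U B. open U \<and> sphere 0 1 \<subseteq> U \<and> C1_on U B \<and> (\<forall>x\<in>sphere 0 1. B x = A x))"

definition delaunay_gamma :: "real \<Rightarrow> real" where
  "delaunay_gamma a = a * (1 + a)"

text \<open>
  For \<open>a = -1/2\<close> the function \<open>x\<close> is constant, so the half-period is fixed by convention;
  the value \<open>h = pi/2\<close> is then forced by the last clause.
\<close>

definition delaunay ::
  "real \<Rightarrow> (real \<Rightarrow> real) \<Rightarrow> (real \<Rightarrow> real) \<Rightarrow> real \<Rightarrow> real \<Rightarrow> bool" where
  "delaunay a x z \<tau> h \<longleftrightarrow>
     (\<exists>x'. (\<forall>t. (x has_real_derivative x' t) (at t)) \<and>
           (\<forall>t. (x' has_real_derivative
                   (1 + 2 * delaunay_gamma a) * x t - 2 * x t ^ 3) (at t)) \<and>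
           x 0 = 1 + a \<and> x' 0 = 0) \<and>
     (\<forall>t. (z has_real_derivative (x t)\<^sup>2 - delaunay_gamma a) (at t)) \<and> z 0 = 0 \<and>
     \<tau> > 0 \<and> (\<forall>t. x (t + 2 * \<tau>) = x t) \<and>
     (if a = - 1/2 then \<tau> = pi
      else \<forall>T. 0 < T \<and> T < 2 * \<tau> \<longrightarrow> \<not> (\<forall>t. x (t + T) = x t)) \<and>
     h > 0 \<and> (\<forall>t. z (t + 2 * \<tau>) = 2 * h + z t)"

text \<open>Parametric surfaces are functions of \<open>(t, \<theta>)\<close>.\<close>

definition d_t :: "(real \<times> real \<Rightarrow> 'a::real_normed_vector) \<Rightarrow> real \<times> real \<Rightarrow> 'a" where
  "d_t X = (\<lambda>(t, \<theta>). vector_derivative (\<lambda>s. X (s, \<theta>)) (at t))"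

definition d_th :: "(real \<times> real \<Rightarrow> 'a::real_normed_vector) \<Rightarrow> real \<times> real \<Rightarrow> 'a" where
  "d_th X = (\<lambda>(t, \<theta>). vector_derivative (\<lambda>s. X (t, s)) (at \<theta>))"

definition regular_at :: "(real \<times> real \<Rightarrow> real^3) \<Rightarrow> real \<times> real \<Rightarrow> bool" where
  "regular_at X p \<longleftrightarrow> cross3 (d_t X p) (d_th X p) \<noteq> 0"

definition unit_normal :: "(real \<times> real \<Rightarrow> real^3) \<Rightarrow> real \<times> real \<Rightarrow> real^3" where
  "unit_normal X p =
     cross3 (d_t X p) (d_th X p) /\<^sub>R norm (cross3 (d_t X p) (d_th X p))"

definition mean_curvature :: "(real \<times> real \<Rightarrow> real^3) \<Rightarrow> real \<times> real \<Rightarrow> real" where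
  "mean_curvature X p =
     (let E = (norm (d_t X p))\<^sup>2;
          F = d_t X p \<bullet> d_th X p;
          G = (norm (d_th X p))\<^sup>2;
          L = d_t (d_t X) p \<bullet> unit_normal X p;
          M = d_th (d_t X) p \<bullet> unit_normal X p;
          N = d_th (d_th X) p \<bullet> unit_normal X p
      in (E * N - 2 * F * M + G * L) / (2 * (E * G - F\<^sup>2)))"

definition delaunay_torus ::
  "nat \<Rightarrow> real \<Rightarrow> (real \<Rightarrow> real) \<Rightarrow> (real \<Rightarrow> real) \<Rightarrow> real \<times> real \<Rightarrow> real^3" where
  "delaunay_torus n h x z = (\<lambda>(t, \<theta>). vector
     [x t * cos \<theta>,
      (real n * h / pi + x t * sin \<theta>) * cos (pi * z t / (real n * h)),
      (real n * h / pi + x t * sin \<theta>) * sin (pi * z t / (real n * h))])"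

definition period_rect :: "nat \<Rightarrow> real \<Rightarrow> (real \<times> real) set" where
  "period_rect n \<tau> = {- (real n * \<tau>) .. real n * \<tau>} \<times> {- pi .. pi}"

text \<open>
  The Hessian is the pair of its rows, so that the product norm is the Frobenius norm.
\<close>

definition hessian :: "(real \<times> real \<Rightarrow> real) \<Rightarrow> real \<times> real \<Rightarrow> (real \<times> real) \<times> (real \<times> real)" where
  "hessian \<phi> p = (grad (\<lambda>q. fst (grad \<phi> q)) p, grad (\<lambda>q. snd (grad \<phi> q)) p)"

text \<open>Suprema are taken in the extended reals, so an unbounded family gives \<open>\<infinity>\<close>.\<close>

definition weighted_C2_norm ::
  "(real \<times> real) set \<Rightarrow> (real \<Rightarrow> real) \<Rightarrow> (real \<times> real \<Rightarrow> real) \<Rightarrow> ereal" where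
  "weighted_C2_norm K x \<phi> =
     (SUP p\<in>K. ereal (inverse (x (fst p)) * (\<bar>\<phi> p\<bar> + norm (grad \<phi> p) + norm (hessian \<phi> p))))"

definition holder_const ::
  "real \<Rightarrow> 'a::metric_space set \<Rightarrow> ('a \<Rightarrow> 'b::metric_space) \<Rightarrow> ereal" where
  "holder_const \<alpha> K F =
     (SUP (p, q)\<in>{(p, q). p \<in> K \<and> q \<in> K \<and> p \<noteq> q}. ereal (dist (F p) (F q) / dist p q powr \<alpha>))"

definition C2_holder :: "real \<Rightarrow> (real \<times> real \<Rightarrow> real) \<Rightarrow> bool" where
  "C2_holder \<alpha> \<phi> \<longleftrightarrow>
     C1_on UNIV \<phi> \<and> C1_on UNIV (\<lambda>q. fst (grad \<phi> q)) \<and> C1_on UNIV (\<lambda>q. snd (grad \<phi> q)) \<and>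
     bounded (range \<phi>) \<and> bounded (range (grad \<phi>)) \<and> bounded (range (hessian \<phi>)) \<and>
     holder_const \<alpha> UNIV (hessian \<phi>) < \<infinity>"

end

theory Submission
  imports Defs
begin

text \<open>
  The contradiction already arises at the single point \<open>(t, \<theta>) = (0, \<pi>/2)\<close>. Bending a Delaunay
  surface into a torus of radius \<open>1/\<epsilon> = n h\<^sub>a/\<pi>\<close> changes its mean curvature there by
  \<open>- \<epsilon>/2 + o(\<epsilon>)\<close>, while the perturbation \<open>\<phi>\<close> contributes \<open>(\<phi>\<^sub>t\<^sub>t + \<phi>\<^sub>\<theta>\<^sub>\<theta> + 2 \<phi>)/2 + o(1/n)\<close>, which is
  at most \<open>R\<^sub>1/n + o(1/n)\<close>. As \<open>\<beta> > 1\<close>, the prescribed curvature is \<open>1 + o(1/n)\<close>, so in the limit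
  \<open>\<pi>/h\<^sub>a \<le> 2 R\<^sub>1 < 2\<close>. But \<open>h\<^sub>a \<le> \<pi>/2\<close>: the angle \<open>\<Phi>\<close> with \<open>\<Phi>' = x\<^sub>a\<close> satisfies
  \<open>x\<^sub>a\<^sup>2 = (1 + a)\<^sup>2 cos\<^sup>2 \<Phi> + a\<^sup>2 sin\<^sup>2 \<Phi>\<close>, hence increases by exactly \<open>\<pi>\<close> over a period, and
  \<open>z\<^sub>a' \<le> x\<^sub>a\<close>.
\<close>

section \<open>The angle and the height of a Delaunay curve\<close>

lemma real_antiderivative:
  fixes f :: "real \<Rightarrow> real"
  assumes "\<And>t. isCont f t"
  obtains F where "\<And>t. (F has_real_derivative f t) (at t)" "F 0 = 0"
proof -
  obtain F where F: "\<And>t. (F has_vector_derivative f t) (at t)"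
    using einterval_antiderivative[of "-\<infinity>" "\<infinity>" f] assms by auto
  show ?thesis
    by (rule that[of "\<lambda>t. F t - F 0"])
      (auto intro!: derivative_eq_intros F[unfolded has_real_derivative_iff_has_vector_derivative[symmetric]])
qed

lemma has_real_derivative_pos_imp_less:
  fixes F :: "real \<Rightarrow> real"
  assumes "\<And>t. (F has_real_derivative f t) (at t)" "\<And>t. f t > 0" "s < t"
  shows "F s < F t"
  using DERIV_pos_imp_increasing[OF \<open>s < t\<close>, of F] assms by blast

text \<open>\<open>D\<close> is the error in the claimed identity. The differential equation gives
  \<open>D' = 2 * x * W\<close> and \<open>W' = - 2 * x * D\<close>, so the pair
  \<open>(D, W)\<close> merely rotates: its length is conserved, and it is zero at
  \<open>t = 0\<close>.\<close>

lemma delaunay_angle_representation: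
  fixes x x' \<Phi> :: "real \<Rightarrow> real"
  assumes x: "\<And>t. (x has_real_derivative x' t) (at t)"
    and x': "\<And>t. (x' has_real_derivative (1 + 2 * delaunay_gamma a) * x t - 2 * x t ^ 3) (at t)"
    and init: "x 0 = 1 + a" "x' 0 = 0"
    and \<Phi>: "\<And>t. (\<Phi> has_real_derivative x t) (at t)" "\<Phi> 0 = 0"
  shows "(x t)\<^sup>2 = (1 + a)\<^sup>2 * (cos (\<Phi> t))\<^sup>2 + a\<^sup>2 * (sin (\<Phi> t))\<^sup>2"
proof -
  define D where "D t = (x t)\<^sup>2 - ((1 + a)\<^sup>2 * (cos (\<Phi> t))\<^sup>2 + a\<^sup>2 * (sin (\<Phi> t))\<^sup>2)" for t
  define W where "W t = x' t + (1 + 2 * a) * sin (\<Phi> t) * cos (\<Phi> t)" for t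
  have s: "(sin u)\<^sup>2 = 1 - (cos u)\<^sup>2" for u :: real
    by (simp add: sin_squared_eq)
  have D: "(D has_real_derivative 2 * x t * W t) (at t)" for t
    unfolding D_def W_def
    by (auto intro!: derivative_eq_intros x x' \<Phi>(1)) (simp add: algebra_simps power2_eq_square)
  have W: "(W has_real_derivative - 2 * x t * D t) (at t)" for t
    unfolding D_def W_def
    apply (rule derivative_eq_intros x x' \<Phi>(1) refl)+
    apply (simp add: delaunay_gamma_def s)
    apply (simp add: algebra_simps power2_eq_square power3_eq_cube)
    using s[of "\<Phi> t"] apply (simp add: power2_eq_square)
    by (simp add: algebra_simps)
  have "((\<lambda>t. (D t)\<^sup>2 + (W t)\<^sup>2) has_real_derivative 0) (at t)" for t
    by (rule derivative_eq_intros D W refl)+ (simp add: algebra_simps)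
  then have "(D t)\<^sup>2 + (W t)\<^sup>2 = (D 0)\<^sup>2 + (W 0)\<^sup>2"
    using DERIV_isconst_all by blast
  also have "\<dots> = 0"
    by (simp add: D_def W_def init \<Phi>(2))
  finally have "D t = 0"
    by (simp add: sum_power2_eq_zero_iff)
  then show ?thesis by (simp add: D_def)
qed

text \<open>Here \<open>x\<close> is a function \<open>g\<close> of the angle, and \<open>g\<close>
  has period \<open>pi\<close>, so \<open>\<Phi>\<close> solves the autonomous equation
  \<open>\<Phi>' = g \<Phi>\<close>. The time \<open>T\<close> at which \<open>\<Phi>\<close>
  reaches \<open>pi\<close> is therefore a period of \<open>x\<close>, and minimality of
  \<open>2 * \<tau>\<close> forces \<open>T = 2 * \<tau>\<close>.\<close>

lemma delaunay_angle:
  assumes del: "delaunay a x z \<tau> h" and a: "a > - 1/2" "a \<noteq> 0"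
  obtains \<Phi> where "\<And>t. (\<Phi> has_real_derivative x t) (at t)" "\<Phi> 0 = 0" "\<And>t. x t > 0"
    "\<And>t. (x t)\<^sup>2 = (1 + a)\<^sup>2 * (cos (\<Phi> t))\<^sup>2 + a\<^sup>2 * (sin (\<Phi> t))\<^sup>2" "\<Phi> (2 * \<tau>) = pi"
proof -
  obtain x' where x: "\<And>t. (x has_real_derivative x' t) (at t)"
    and x': "\<And>t. (x' has_real_derivative (1 + 2 * delaunay_gamma a) * x t - 2 * x t ^ 3) (at t)"
    and init: "x 0 = 1 + a" "x' 0 = 0"
    and \<tau>: "\<tau> > 0" "\<And>t. x (t + 2 * \<tau>) = x t"
    and minimal: "\<And>T. 0 < T \<Longrightarrow> T < 2 * \<tau> \<Longrightarrow> \<not> (\<forall>t. x (t + T) = x t)"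
    using del a unfolding delaunay_def by (auto split: if_splits)
  have cont: "isCont x t" for t
    using x DERIV_isCont by blast
  obtain \<Phi> where \<Phi>: "\<And>t. (\<Phi> has_real_derivative x t) (at t)" "\<Phi> 0 = 0"
    using real_antiderivative[of x] cont by blast
  define g where "g u = sqrt ((1 + a)\<^sup>2 * (cos u)\<^sup>2 + a\<^sup>2 * (sin u)\<^sup>2)" for u
  have g_pos: "g u > 0" for u
  proof (cases "cos u = 0")
    case True
    then have "(sin u)\<^sup>2 = 1" by (simp add: sin_squared_eq)
    then show ?thesis using True a by (simp add: g_def)
  next
    case False
    then have "(1 + a)\<^sup>2 * (cos u)\<^sup>2 > 0" using a by simp
    then show ?thesis unfolding g_def
      by (metis add_pos_nonneg mult_nonneg_nonneg real_sqrt_gt_0_iff zero_le_power2)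
  qed
  have sq: "(x t)\<^sup>2 = (1 + a)\<^sup>2 * (cos (\<Phi> t))\<^sup>2 + a\<^sup>2 * (sin (\<Phi> t))\<^sup>2" for t
    by (rule delaunay_angle_representation[OF x x' init \<Phi>])
  then have sq_g: "(x t)\<^sup>2 = (g (\<Phi> t))\<^sup>2" for t
    by (simp add: g_def)
  have nz: "x t \<noteq> 0" for t
    using sq_g[of t] g_pos[of "\<Phi> t"] by auto
  \<comment> \<open>As \<open>x\<close> has no zero, connectedness of its range lets it keep the
    sign of \<open>x 0 = 1 + a\<close>.\<close>
  have conn: "connected (range x)"
    by (intro connected_continuous_image) (auto simp: cont continuous_at_imp_continuous_on)
  have x_pos: "x t > 0" for t
  proof (rule ccontr)
    assume "\<not> x t > 0"
    moreover have "x 0 > 0" using init a by simp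
    ultimately have "0 \<in> range x"
      using conn unfolding connected_iff_interval by (metis linorder_not_le nle_le rangeI)
    with nz show False by (metis imageE)
  qed
  have x_g: "x t = g (\<Phi> t)" for t
    using sq_g[of t] x_pos[of t] g_pos[of "\<Phi> t"] by (simp add: power2_eq_iff)
  \<comment> \<open>After one period \<open>x\<close> is back at \<open>1 + a\<close>, which forces
    \<open>sin \<Phi> = 0\<close> because \<open>1 + 2 * a \<noteq> 0\<close>. Since
    \<open>\<Phi>\<close> has become positive, it must have reached \<open>pi\<close> by
    then.\<close>
  have "(x (2 * \<tau>))\<^sup>2 = (1 + a)\<^sup>2"
    using \<tau>(2)[of 0] init by simp
  then have "(1 + a)\<^sup>2 * (1 - (sin (\<Phi> (2 * \<tau>)))\<^sup>2) + a\<^sup>2 * (sin (\<Phi> (2 * \<tau>)))\<^sup>2 = (1 + a)\<^sup>2"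
    using sq[of "2 * \<tau>"] by (simp add: cos_squared_eq)
  then have "(1 + 2 * a) * (sin (\<Phi> (2 * \<tau>)))\<^sup>2 = 0"
    by (simp add: algebra_simps power2_eq_square)
  then have "sin (\<Phi> (2 * \<tau>)) = 0" using a by simp
  moreover have "\<Phi> (2 * \<tau>) > 0"
    using has_real_derivative_pos_imp_less[OF \<Phi>(1) x_pos, of 0 "2 * \<tau>"] \<Phi>(2) \<tau>(1) by simp
  ultimately have "\<Phi> (2 * \<tau>) \<ge> pi"
    using sin_gt_zero by force
  then obtain T where T: "0 \<le> T" "T \<le> 2 * \<tau>" "\<Phi> T = pi"
    using IVT'[of \<Phi> 0 pi "2 * \<tau>"] \<Phi> \<tau>(1) pi_ge_zero
    by (metis DERIV_isCont continuous_at_imp_continuous_on mult_nonneg_nonneg order_less_imp_le zero_le_numeral)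
  have "isCont (\<lambda>u. 1 / g u) u" for u
    using g_pos[of u] unfolding g_def by (intro continuous_intros) auto
  then obtain G where G: "\<And>u. (G has_real_derivative 1 / g u) (at u)"
    using real_antiderivative[of "\<lambda>u. 1 / g u"] by blast
  \<comment> \<open>\<open>G\<close> inverts \<open>\<Phi>\<close> up to a constant, so \<open>\<Phi>\<close> is the only solution of its autonomous equation.\<close>
  have G_comp: "G (\<Psi> t) - t = G (\<Psi> 0)"
    if "\<And>t. (\<Psi> has_real_derivative g (\<Psi> t)) (at t)" for \<Psi> t
  proof -
    have "((\<lambda>t. G (\<Psi> t) - t) has_real_derivative 0) (at t)" for t
      by (rule derivative_eq_intros DERIV_chain2[OF G] that refl)+
        (use g_pos[of "\<Psi> t"] in simp)
    then have "(\<lambda>t. G (\<Psi> t) - t) t = (\<lambda>t. G (\<Psi> t) - t) 0"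
      using DERIV_isconst_all by blast
    then show ?thesis by simp
  qed
  have g_shift: "g (u - pi) = g u" for u
    by (simp add: g_def)
  \<comment> \<open>The shifted angle solves the same equation with the same initial value 0;
    injectivity of \<open>G\<close> identifies it with \<open>\<Phi>\<close>.\<close>
  have "((\<lambda>t. \<Phi> (t + T) - pi) has_real_derivative g (\<Phi> (t + T) - pi)) (at t)" for t
    using DERIV_shift[of \<Phi> "x (t + T)" t T] \<Phi>(1)
    by (auto intro!: derivative_eq_intros simp: g_shift x_g)
  from G_comp[of "\<lambda>t. \<Phi> (t + T) - pi", OF this]
  have "G (\<Phi> (t + T) - pi) = G (\<Phi> t)" for t
    using G_comp[of \<Phi> t] \<Phi> T(3) by (simp add: x_g diff_eq_eq)
  moreover have "G u < G v" if "u < v" for u v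
    using has_real_derivative_pos_imp_less[OF G _ that] g_pos by simp
  ultimately have "\<Phi> (t + T) - pi = \<Phi> t" for t
    by (metis linorder_neq_iff order_less_irrefl)
  then have "x (t + T) = x t" for t
    using g_shift[of "\<Phi> (t + T)"] by (simp add: x_g)
  moreover have "T \<noteq> 0" using T(3) \<Phi>(2) by auto
  ultimately have "T = 2 * \<tau>"
    using minimal[of T] T by force
  with T(3) show ?thesis
    using that \<Phi> x_pos sq by blast
qed

lemma delaunay_height_le:
  assumes del: "delaunay a x z \<tau> h" and a: "a > - 1/2" "a \<noteq> 0"
  shows "h \<le> pi / 2"
proof -
  obtain \<Phi> where \<Phi>: "\<And>t. (\<Phi> has_real_derivative x t) (at t)" "\<Phi> 0 = 0" and pos: "\<And>t. x t > 0"
    and sq: "\<And>t. (x t)\<^sup>2 = (1 + a)\<^sup>2 * (cos (\<Phi> t))\<^sup>2 + a\<^sup>2 * (sin (\<Phi> t))\<^sup>2"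
    and period: "\<Phi> (2 * \<tau>) = pi"
    using delaunay_angle[OF assms] by blast
  have z: "\<And>t. (z has_real_derivative (x t)\<^sup>2 - delaunay_gamma a) (at t)" "z 0 = 0"
    and \<tau>: "\<tau> > 0" and h: "z (0 + 2 * \<tau>) = 2 * h + z 0"
    using del unfolding delaunay_def by blast+
  \<comment> \<open>In terms of \<open>c\<close> and \<open>s\<close>, the height derivative is
    \<open>(1 + a) * c - a * s\<close>; the gap between \<open>x\<^sup>2\<close> and its square is a
    visibly nonnegative product.\<close>
  have le: "(x t)\<^sup>2 - delaunay_gamma a \<le> x t" for t
  proof -
    define c s where "c = (cos (\<Phi> t))\<^sup>2" and "s = (sin (\<Phi> t))\<^sup>2"
    have "0 \<le> c" "0 \<le> s"
      by (simp_all add: c_def s_def)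
    have s: "s = 1 - c"
      by (simp add: c_def s_def sin_squared_eq)
    have "(x t)\<^sup>2 - ((x t)\<^sup>2 - delaunay_gamma a)\<^sup>2 = c * s * (1 + 2 * a)\<^sup>2"
      unfolding sq c_def[symmetric] s_def[symmetric] delaunay_gamma_def s
      by (simp add: algebra_simps power2_eq_square)
    also have "\<dots> \<ge> 0" using \<open>0 \<le> c\<close> \<open>0 \<le> s\<close> by simp
    finally show ?thesis
      using pos[of t] power2_le_imp_le[of "(x t)\<^sup>2 - delaunay_gamma a" "x t"] by simp
  qed
  have "((\<lambda>t. z t - \<Phi> t) has_real_derivative (x t)\<^sup>2 - delaunay_gamma a - x t) (at t)" for t
    by (auto intro!: derivative_eq_intros z \<Phi>)
  then have "z (2 * \<tau>) - \<Phi> (2 * \<tau>) \<le> z 0 - \<Phi> 0"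
    using DERIV_nonpos_imp_nonincreasing[of 0 "2 * \<tau>" "\<lambda>t. z t - \<Phi> t"] le \<tau>
    by (smt (verit))
  then show ?thesis using h z \<Phi> period by simp
qed

text \<open>This keeps \<open>pi / h\<close> bounded along the sequence. The height derivative
  dominates \<open>(1 + a) * x\<close> times a trigonometric polynomial in \<open>\<Phi>\<close>,
  which is integrated exactly over the angle interval from 0 to \<open>pi\<close>.\<close>

lemma delaunay_height_ge:
  assumes del: "delaunay a x z \<tau> h" and a: "\<bar>a\<bar> \<le> 1/200" "a \<noteq> 0"
  shows "h \<ge> pi / 128"
proof -
  have a': "a > - 1/2" using a by linarith
  obtain \<Phi> where \<Phi>: "\<And>t. (\<Phi> has_real_derivative x t) (at t)" "\<Phi> 0 = 0" and pos: "\<And>t. x t > 0"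
    and sq: "\<And>t. (x t)\<^sup>2 = (1 + a)\<^sup>2 * (cos (\<Phi> t))\<^sup>2 + a\<^sup>2 * (sin (\<Phi> t))\<^sup>2"
    and period: "\<Phi> (2 * \<tau>) = pi"
    using delaunay_angle[OF del a' a(2)] by blast
  have z: "\<And>t. (z has_real_derivative (x t)\<^sup>2 - delaunay_gamma a) (at t)" "z 0 = 0"
    and \<tau>: "\<tau> > 0" and h: "z (0 + 2 * \<tau>) = 2 * h + z 0"
    using del unfolding delaunay_def by blast+
  \<comment> \<open>The polynomial \<open>(3 * c\<^sup>2 - c ^ 4) / 2\<close> lies below
    \<open>c = \<bar>cos \<Phi>\<bar>\<close> and contains only even powers, which removes the
    absolute value. Its mean 9/16 beats the mean 1/2 of \<open>sin\<^sup>2\<close> by 1/16; half of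
    that margin, 1/32, is spent on absorbing \<open>a\<close>.\<close>
  have ge: "(1 + a) * x t * ((3 * (cos (\<Phi> t))\<^sup>2 - (cos (\<Phi> t)) ^ 4) / 2 - (sin (\<Phi> t))\<^sup>2 - 1/32)
      \<le> (x t)\<^sup>2 - delaunay_gamma a" for t
  proof -
    define c s where "c = \<bar>cos (\<Phi> t)\<bar>" and "s = (sin (\<Phi> t))\<^sup>2"
    have c: "0 \<le> c" "c \<le> 1" and "0 \<le> s"
      by (simp_all add: c_def s_def)
    have s: "s = 1 - c\<^sup>2"
      by (simp add: c_def s_def sin_squared_eq)
    have x2: "(x t)\<^sup>2 = ((1 + a) * c)\<^sup>2 + a\<^sup>2 * s"
      by (simp add: sq c_def s_def power_mult_distrib)
    have xc: "x t \<ge> (1 + a) * c"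
    proof (rule power2_le_imp_le)
      show "((1 + a) * c)\<^sup>2 \<le> (x t)\<^sup>2"
        unfolding x2 using \<open>0 \<le> s\<close> by simp
    qed (use pos[of t] in simp)
    have xa: "x t \<ge> \<bar>a\<bar>"
    proof (rule power2_le_imp_le)
      have "a\<^sup>2 * c\<^sup>2 \<le> (1 + a)\<^sup>2 * c\<^sup>2"
        using a by (intro mult_right_mono) (auto simp: abs_le_square_iff[symmetric])
      then show "\<bar>a\<bar>\<^sup>2 \<le> (x t)\<^sup>2"
        unfolding x2 s power_mult_distrib by (simp add: right_diff_distrib)
    qed (use pos[of t] in simp)
    \<comment> \<open>Where the cosine is small, \<open>s + 1/32 \<ge> 1\<close> and
      \<open>x \<ge> \<bar>a\<bar>\<close> suffices. Elsewhere \<open>1/32 > 1/36\<close> gives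
      \<open>c > 1/6\<close>, and the product is at least 199/38400, just above 1/200; the bound on
      \<open>a\<close> comes from here.\<close>
    have "a \<le> x t * (s + 1/32)"
    proof (cases "c\<^sup>2 \<le> 1/32")
      case True
      then have "x t * 1 \<le> x t * (s + 1/32)"
        using pos[of t] by (intro mult_left_mono) (auto simp: s)
      then show ?thesis using xa by linarith
    next
      case False
      then have "c > 1/6" using c power_mono[of c "1/6" 2] by (cases "c \<le> 1/6") (auto simp: power2_eq_square)
      then have "(1 + a) * c \<ge> (199/200) * (1/6)"
        using a by (intro mult_mono) auto
      then have "x t \<ge> (199/200) * (1/6)" using xc by linarith
      then have "x t * (s + 1/32) \<ge> (199/200) * (1/6) * (1/32)"
        using \<open>0 \<le> s\<close> by (intro mult_mono) auto
      then show ?thesis using a by simp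
    qed
    then have g: "delaunay_gamma a \<le> (1 + a) * (x t * (s + 1/32))"
      using a' by (auto simp: delaunay_gamma_def intro: mult_left_mono)
    have "c - (3 * c\<^sup>2 - c ^ 4) / 2 = c * (1 - c)\<^sup>2 * (2 + c) / 2"
      by (simp add: field_simps power2_eq_square power4_eq_xxxx)
    also have "\<dots> \<ge> 0" using c by simp
    finally have "(3 * c\<^sup>2 - c ^ 4) / 2 \<le> c" by simp
    moreover define q where "q = (3 * c\<^sup>2 - c ^ 4) / 2"
    ultimately have "(1 + a) * q \<le> (1 + a) * c"
      using a' by (intro mult_left_mono) auto
    then have "(1 + a) * q * x t \<le> x t * x t"
      using xc pos[of t] by (intro mult_right_mono) auto
    then have "(1 + a) * x t * (q - s - 1/32) \<le> (x t)\<^sup>2 - delaunay_gamma a"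
      using g by (simp add: algebra_simps power2_eq_square)
    then show ?thesis by (simp add: q_def c_def s_def)
  qed
  \<comment> \<open>The antiderivative of the trigonometric polynomial: its oscillating terms vanish
    at 0 and \<open>pi\<close>, so it gains exactly \<open>pi / 32\<close>.\<close>
  define P where "P u = u / 32 + 17/16 * (sin u * cos u) - sin u * cos u ^ 3 / 8" for u :: real
  have P: "(P has_real_derivative (3 * (cos u)\<^sup>2 - (cos u) ^ 4) / 2 - (sin u)\<^sup>2 - 1/32) (at u)" for u
    unfolding P_def
  proof -
    define S C where "S = sin u" and "C = cos u"
    have S: "S\<^sup>2 = 1 - C\<^sup>2" by (simp add: S_def C_def sin_squared_eq)
    have eq: "1/32 + 17/16 * (C\<^sup>2 - S\<^sup>2) - (C ^ 4 - 3 * C\<^sup>2 * S\<^sup>2) / 8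
        = (3 * C\<^sup>2 - C ^ 4) / 2 - S\<^sup>2 - 1/32"
      unfolding S by (simp add: field_simps flip: power_add)
    have "((\<lambda>u. u / 32 + 17/16 * (sin u * cos u) - sin u * cos u ^ 3 / 8)
        has_real_derivative 1/32 + 17/16 * (C\<^sup>2 - S\<^sup>2) - (C ^ 4 - 3 * C\<^sup>2 * S\<^sup>2) / 8) (at u)"
      unfolding S_def C_def
      by (auto intro!: derivative_eq_intros simp: field_simps power2_eq_square power3_eq_cube power4_eq_xxxx)
    from DERIV_cong[OF this eq] show "((\<lambda>u. u / 32 + 17/16 * (sin u * cos u) - sin u * cos u ^ 3 / 8)
        has_real_derivative (3 * (cos u)\<^sup>2 - (cos u) ^ 4) / 2 - (sin u)\<^sup>2 - 1/32) (at u)"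
      unfolding S_def C_def .
  qed
  have "((\<lambda>t. z t - (1 + a) * P (\<Phi> t)) has_real_derivative (x t)\<^sup>2 - delaunay_gamma a
     - (1 + a) * x t * ((3 * (cos (\<Phi> t))\<^sup>2 - (cos (\<Phi> t)) ^ 4) / 2 - (sin (\<Phi> t))\<^sup>2 - 1/32)) (at t)" for t
    by (rule derivative_eq_intros DERIV_chain2[OF P] z \<Phi> refl)+ simp
  then have "z (2 * \<tau>) - (1 + a) * P (\<Phi> (2 * \<tau>)) \<ge> z 0 - (1 + a) * P (\<Phi> 0)"
    using DERIV_nonneg_imp_nondecreasing[of 0 "2 * \<tau>" "\<lambda>t. z t - (1 + a) * P (\<Phi> t)"] ge \<tau>
    by (smt (verit))
  then have "2 * h \<ge> (1 + a) * (pi / 32)" using h z \<Phi> period by (simp add: P_def)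
  moreover have "(1 + a) * (pi / 32) \<ge> (1/2) * (pi / 32)"
    using a' by (intro mult_right_mono) auto
  ultimately show ?thesis by linarith
qed

section \<open>The perturbed torus at the base point\<close>

lemma has_gderiv_grad:
  fixes f :: "'a::euclidean_space \<Rightarrow> real"
  assumes "f differentiable (at x)"
  shows "GDERIV f x :> grad f x"
proof -
  obtain f' where f': "(f has_derivative f') (at x)"
    using assms by (auto simp: differentiable_def)
  then have lin: "linear f'"
    using has_derivative_linear by blast
  \<comment> \<open>\<open>grad\<close> is a definite description, so existence and uniqueness of
    the representing vector are both required. Existence is Riesz representation in the standard
    basis.\<close>
  define g where "g = (\<Sum>b\<in>Basis. f' b *\<^sub>R b)"
  have "f' v = v \<bullet> g" for v
  proof -
    have "f' v = f' (\<Sum>b\<in>Basis. (v \<bullet> b) *\<^sub>R b)" by (simp add: euclidean_representation)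
    also have "\<dots> = v \<bullet> g"
      by (simp add: linear_sum[OF lin] linear_scale[OF lin] g_def inner_sum_right mult.commute)
    finally show ?thesis .
  qed
  then have "GDERIV f x :> g"
    using f' by (metis (no_types, lifting) ext gderiv_def)
  moreover have "g' = g" if "GDERIV f x :> g'" for g'
  proof -
    have "(\<lambda>h. h \<bullet> g') = (\<lambda>h. h \<bullet> g)"
      using that \<open>GDERIV f x :> g\<close> unfolding gderiv_def by (rule has_derivative_unique)
    then show ?thesis by (metis vector_eq_ldot)
  qed
  ultimately show ?thesis
    unfolding grad_def by (metis theI)
qed

lemma has_real_derivative_partials:
  fixes f :: "real \<times> real \<Rightarrow> real"
  assumes "f differentiable (at (t, \<theta>))"
  shows "((\<lambda>s. f (s, \<theta>)) has_real_derivative fst (grad f (t, \<theta>))) (at t)"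
    and "((\<lambda>s. f (t, s)) has_real_derivative snd (grad f (t, \<theta>))) (at \<theta>)"
proof -
  have f: "(f has_derivative (\<lambda>v. v \<bullet> grad f (t, \<theta>))) (at (t, \<theta>))"
    using has_gderiv_grad[OF assms] by (simp add: gderiv_def)
  have "((\<lambda>s. (s, \<theta>)) has_derivative (\<lambda>v. (v, 0))) (at t)"
    by (auto intro!: derivative_eq_intros)
  from has_derivative_compose[OF this f]
  show "((\<lambda>s. f (s, \<theta>)) has_real_derivative fst (grad f (t, \<theta>))) (at t)"
    by (simp add: has_field_derivative_def inner_prod_def mult.commute[of _ "fst _"])
  have "((\<lambda>s. (t, s)) has_derivative (\<lambda>v. (0, v))) (at \<theta>)"
    by (auto intro!: derivative_eq_intros)
  from has_derivative_compose[OF this f]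
  show "((\<lambda>s. f (t, s)) has_real_derivative snd (grad f (t, \<theta>))) (at \<theta>)"
    by (simp add: has_field_derivative_def inner_prod_def mult.commute[of _ "snd _"])
qed

lemma has_vector_derivative_vector3:
  assumes "(f has_real_derivative f') (at t)" "(g has_real_derivative g') (at t)"
    "(k has_real_derivative k') (at t)"
  shows "((\<lambda>s. vector [f s, g s, k s] :: real^3) has_vector_derivative vector [f', g', k']) (at t)"
proof -
  have eq: "vector [u, v, w] = u *\<^sub>R axis 1 1 + v *\<^sub>R axis 2 1 + w *\<^sub>R (axis 3 1 :: real^3)" for u v w :: real
    by (simp add: vec_eq_iff forall_3 axis_def)
  show ?thesis
    unfolding eq
    using assms[THEN has_real_derivative_iff_has_vector_derivative[THEN iffD1]]
    by (auto intro!: derivative_eq_intros assms)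
qed

text \<open>Agreement on an open neighbourhood is all that is asked for, because the explicit
  formulas for the perturbed surface hold only where certain factors are positive.\<close>

lemma vector_derivative_vector3:
  assumes "open U" "t \<in> U" "\<And>s. s \<in> U \<Longrightarrow> F s = (vector [f s, g s, k s] :: real^3)"
    and "(f has_real_derivative f') (at t)" "(g has_real_derivative g') (at t)"
    "(k has_real_derivative k') (at t)"
  shows "vector_derivative F (at t) = vector [f', g', k']"
  by (rule vector_derivative_at,
      rule has_vector_derivative_transform_within_open[OF has_vector_derivative_vector3[OF assms(4-6)] assms(1,2)])
    (simp add: assms(3))

lemma normalize_eq:
  fixes u v :: "'a::real_normed_vector"
  assumes "u = c *\<^sub>R v" "c > 0" "norm v = 1"
  shows "u /\<^sub>R norm u = v"
  using assms by simp

lemma open_sin_pos: "open {\<theta>::real. sin \<theta> > 0}"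
  by (intro open_Collect_less continuous_intros)

section \<open>The bent tube and its unit normal\<close>

definition bent_tube :: "real \<Rightarrow> (real \<Rightarrow> real) \<Rightarrow> (real \<Rightarrow> real) \<Rightarrow> real \<times> real \<Rightarrow> real^3" where
  "bent_tube \<epsilon> x z = (\<lambda>(t, \<theta>). vector
     [x t * cos \<theta>,
      (1 / \<epsilon> + x t * sin \<theta>) * cos (\<epsilon> * z t),
      (1 / \<epsilon> + x t * sin \<theta>) * sin (\<epsilon> * z t)])"

text \<open>\<open>n\<close> and \<open>h\<close> enter the torus only through the bending curvature
  \<open>\<epsilon>\<close>, the reciprocal of its radius.\<close>

lemma delaunay_torus_eq_bent_tube:
  "delaunay_torus n h x z = bent_tube (pi / (real n * h)) x z"
  by (simp add: delaunay_torus_def bent_tube_def)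

text \<open>Fixes one member of the sequence, so that all derivatives at the base point are computed
  before any limit is taken.\<close>

locale bent_delaunay =
  fixes a \<epsilon> :: real and x x' z :: "real \<Rightarrow> real" and \<phi> :: "real \<times> real \<Rightarrow> real"
  assumes a: "a > - 1/2" and \<epsilon>: "\<epsilon> > 0"
    and x: "\<And>t. (x has_real_derivative x' t) (at t)"
    and x': "\<And>t. (x' has_real_derivative (1 + 2 * delaunay_gamma a) * x t - 2 * x t ^ 3) (at t)"
    and z: "\<And>t. (z has_real_derivative (x t)\<^sup>2 - delaunay_gamma a) (at t)"
    and init: "x 0 = 1 + a" "x' 0 = 0" "z 0 = 0"
    and \<phi>: "\<And>p. \<phi> differentiable (at p)" "\<And>p. (\<lambda>q. fst (grad \<phi> q)) differentiable (at p)"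
      "\<And>p. (\<lambda>q. snd (grad \<phi> q)) differentiable (at p)"
begin

definition "dz t = (x t)\<^sup>2 - delaunay_gamma a"

definition "ddx t = (1 + 2 * delaunay_gamma a) * x t - 2 * x t ^ 3"

text \<open>The factor by which bending lengthens the axial direction at a point of the
  tube.\<close>

definition "stretch t \<theta> = 1 + \<epsilon> * x t * sin \<theta>"

text \<open>The inclination of the normal of the tube against the horizontal plane of the bent frame.\<close>

definition "incl t \<theta> = arctan (x' t / (stretch t \<theta> * dz t))"

definition "surf p = bent_tube \<epsilon> x z p + \<phi> p *\<^sub>R unit_normal (bent_tube \<epsilon> x z) p"

lemma derivs:
  "(x has_real_derivative x' t) (at t)" "(x' has_real_derivative ddx t) (at t)"
  "(z has_real_derivative dz t) (at t)" "(dz has_real_derivative 2 * x t * x' t) (at t)"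
  "(ddx has_real_derivative (1 + 2 * delaunay_gamma a - 6 * (x t)\<^sup>2) * x' t) (at t)"
  using x x' z unfolding dz_def[abs_def] ddx_def[abs_def]
  by (auto intro!: derivative_eq_intros x simp: algebra_simps)

lemma at_zero: "dz 0 = 1 + a" "ddx 0 = - ((1 + 2 * a) * (1 + a))"
  by (simp_all add: dz_def ddx_def init delaunay_gamma_def power2_eq_square power3_eq_cube algebra_simps)

lemma tube_t:
  "d_t (bent_tube \<epsilon> x z) (t, \<theta>) = vector
    [x' t * cos \<theta>,
     x' t * sin \<theta> * cos (\<epsilon> * z t) - stretch t \<theta> * dz t * sin (\<epsilon> * z t),
     x' t * sin \<theta> * sin (\<epsilon> * z t) + stretch t \<theta> * dz t * cos (\<epsilon> * z t)]"
  unfolding d_t_def bent_tube_def prod.case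
  apply (rule vector_derivative_vector3[OF open_UNIV UNIV_I refl])
    apply (rule derivative_eq_intros derivs refl)+
    apply simp
  using \<epsilon> by (auto intro!: derivative_eq_intros derivs simp: stretch_def field_simps)

lemma tube_th:
  "d_th (bent_tube \<epsilon> x z) (t, \<theta>) = vector
    [- x t * sin \<theta>, x t * cos \<theta> * cos (\<epsilon> * z t), x t * cos \<theta> * sin (\<epsilon> * z t)]"
  unfolding d_th_def bent_tube_def prod.case
  by (rule vector_derivative_vector3[OF open_UNIV UNIV_I refl])
    (auto intro!: derivative_eq_intros)

text \<open>Expressing the normal by an angle makes its unit length automatic and turns later
  differentiations into those of sines and cosines. The cross product is the positive multiple
  \<open>?c\<close> of this vector, which also settles the inward orientation.\<close>

lemma tube_normal:
  assumes "x t > 0" "dz t > 0" "stretch t \<theta> > 0"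
  shows "unit_normal (bent_tube \<epsilon> x z) (t, \<theta>) = vector
    [- cos (incl t \<theta>) * cos \<theta>,
     - cos (incl t \<theta>) * sin \<theta> * cos (\<epsilon> * z t) - sin (incl t \<theta>) * sin (\<epsilon> * z t),
     - cos (incl t \<theta>) * sin \<theta> * sin (\<epsilon> * z t) + sin (incl t \<theta>) * cos (\<epsilon> * z t)]" (is "_ = ?v")
  unfolding unit_normal_def
proof (rule normalize_eq)
  let ?c = "x t * (stretch t \<theta> * dz t) / cos (incl t \<theta>)"
  have c: "cos (incl t \<theta>) > 0"
    by (simp add: incl_def cos_arctan add_pos_nonneg)
  then show "?c > 0" using assms by simp
  have c1: "?c * cos (incl t \<theta>) = x t * (stretch t \<theta> * dz t)"
    using c by simp
  have "tan (incl t \<theta>) = x' t / (stretch t \<theta> * dz t)"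
    by (simp add: incl_def tan_arctan)
  then have c2: "?c * sin (incl t \<theta>) = x t * x' t"
    using assms c by (simp add: tan_def field_simps)
  \<comment> \<open>With letters in place of sines and cosines, both vector identities become
    polynomial identities modulo the Pythagorean relations \<open>sq\<close>.\<close>
  define K where "K = ?c"
  define C S where "C = cos (\<epsilon> * z t)" and "S = sin (\<epsilon> * z t)"
  define C' S' where "C' = cos \<theta>" and "S' = sin \<theta>"
  define C'' S'' where "C'' = cos (incl t \<theta>)" and "S'' = sin (incl t \<theta>)"
  have sq: "S * S = 1 - C * C" "S' * S' = 1 - C' * C'" "S'' * S'' = 1 - C'' * C''"
    unfolding C_def S_def C'_def S'_def C''_def S''_def
    by (simp_all add: sin_squared_eq flip: power2_eq_square)
  have K: "K * C'' = x t * (stretch t \<theta> * dz t)" "K * S'' = x t * x' t"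
    using c1 c2 by (simp_all add: K_def C''_def S''_def)
  have "cross3 (d_t (bent_tube \<epsilon> x z) (t, \<theta>)) (d_th (bent_tube \<epsilon> x z) (t, \<theta>))
     = vector [- K * C'' * C', - K * C'' * S' * C - K * S'' * S, - K * C'' * S' * S + K * S'' * C]"
    unfolding tube_t tube_th
    unfolding C_def[symmetric] S_def[symmetric] C'_def[symmetric] S'_def[symmetric]
    apply (simp add: cross3_def vec_eq_iff forall_3 K)
    using sq by algebra
  also have "\<dots> = K *\<^sub>R ?v"
    unfolding C_def[symmetric] S_def[symmetric] C'_def[symmetric] S'_def[symmetric]
      C''_def[symmetric] S''_def[symmetric]
    by (simp add: vec_eq_iff forall_3 algebra_simps)
  finally show "cross3 (d_t (bent_tube \<epsilon> x z) (t, \<theta>)) (d_th (bent_tube \<epsilon> x z) (t, \<theta>)) = ?c *\<^sub>R ?v"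
    unfolding K_def .
  show "norm ?v = 1"
    unfolding C_def[symmetric] S_def[symmetric] C'_def[symmetric] S'_def[symmetric]
      C''_def[symmetric] S''_def[symmetric]
    apply (simp add: norm_eq_1 inner_vec_def sum_3)
    using sq by algebra
qed

lemma surf_eq:
  assumes "x t > 0" "dz t > 0" "stretch t \<theta> > 0"
  shows "surf (t, \<theta>) = vector
    [(x t - \<phi> (t, \<theta>) * cos (incl t \<theta>)) * cos \<theta>,
     (1 / \<epsilon> + x t * sin \<theta>) * cos (\<epsilon> * z t)
       - \<phi> (t, \<theta>) * (cos (incl t \<theta>) * sin \<theta> * cos (\<epsilon> * z t) + sin (incl t \<theta>) * sin (\<epsilon> * z t)),
     (1 / \<epsilon> + x t * sin \<theta>) * sin (\<epsilon> * z t)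
       - \<phi> (t, \<theta>) * (cos (incl t \<theta>) * sin \<theta> * sin (\<epsilon> * z t) - sin (incl t \<theta>) * cos (\<epsilon> * z t))]"
proof -
  have "bent_tube \<epsilon> x z (t, \<theta>) = vector [x t * cos \<theta>, (1 / \<epsilon> + x t * sin \<theta>) * cos (\<epsilon> * z t),
      (1 / \<epsilon> + x t * sin \<theta>) * sin (\<epsilon> * z t)]"
    by (simp add: bent_tube_def)
  then show ?thesis
    unfolding surf_def tube_normal[OF assms]
    by (simp add: vec_eq_iff forall_3) (simp add: algebra_simps)
qed

section \<open>The turning rate of the normal near \<open>t = 0\<close>\<close>

definition "good = {t. x t > 0 \<and> dz t > 0}"

lemma good: "open good" "0 \<in> good"
proof -
  have "continuous_on UNIV x" "continuous_on UNIV dz"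
    using derivs by (meson DERIV_isCont continuous_at_imp_continuous_on)+
  then show "open good"
    unfolding good_def by (intro open_Collect_conj open_Collect_less continuous_intros) auto
  show "0 \<in> good" using a by (simp add: good_def at_zero init)
qed

lemma stretch_pos: "t \<in> good \<Longrightarrow> sin \<theta> > 0 \<Longrightarrow> stretch t \<theta> > 0"
  using \<epsilon> by (simp add: good_def stretch_def add_pos_pos)

definition "incl_num t \<theta> = ddx t * (stretch t \<theta> * dz t)
   - x' t * (\<epsilon> * x' t * sin \<theta> * dz t + stretch t \<theta> * (2 * x t * x' t))"

definition "incl_den t \<theta> = (stretch t \<theta> * dz t)\<^sup>2 + (x' t)\<^sup>2"

definition "incl_rate t \<theta> = incl_num t \<theta> / incl_den t \<theta>"

lemma incl_t:
  assumes "t \<in> good" "sin \<theta> > 0"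
  shows "((\<lambda>t. incl t \<theta>) has_real_derivative incl_rate t \<theta>) (at t)"
proof -
  have "stretch t \<theta> * dz t > 0"
    using assms stretch_pos[OF assms] by (simp add: good_def)
  define q where "q = stretch t \<theta> * dz t"
  have q: "((\<lambda>t. stretch t \<theta> * dz t) has_real_derivative
      \<epsilon> * x' t * sin \<theta> * dz t + stretch t \<theta> * (2 * x t * x' t)) (at t)"
    unfolding stretch_def by (auto intro!: derivative_eq_intros derivs)
  have "q > 0" using q_def \<open>stretch t \<theta> * dz t > 0\<close> by simp
  have eq: "inverse (1 + (u / q)\<^sup>2) * ((v * q - u * w) / (q * q)) = (v * q - u * w) / (q\<^sup>2 + u\<^sup>2)" for u v w
  proof -
    have "1 + (u / q)\<^sup>2 = (q\<^sup>2 + u\<^sup>2) / q\<^sup>2"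
      using \<open>q > 0\<close> by (simp add: field_simps)
    then show ?thesis
      using \<open>q > 0\<close> by (simp add: power2_eq_square)
  qed
  show ?thesis
    unfolding incl_def incl_rate_def incl_num_def incl_den_def q_def[symmetric]
    by (rule DERIV_cong[OF DERIV_chain2[OF DERIV_arctan DERIV_divide[OF derivs(2) q]]])
      (use \<open>q > 0\<close> eq in \<open>auto simp: q_def\<close>)
qed

text \<open>Reflection symmetry at \<open>t = 0\<close>: the derivatives of \<open>x\<close>,
  \<open>dz\<close>, \<open>ddx\<close> and \<open>stretch\<close> all carry the factor
  \<open>x'\<close>, which vanishes there, so numerator and denominator are both stationary. This
  removes the second derivative of the inclination from \<open>surf_tt_base\<close>.\<close>

lemma incl_rate_t: "((\<lambda>t. incl_rate t (pi/2)) has_real_derivative 0) (at 0)"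
proof -
  have "stretch 0 (pi/2) * dz 0 > 0"
    using stretch_pos[OF good(2), of "pi/2"] a by (simp add: at_zero)
  then have d: "incl_den 0 (pi/2) > 0" unfolding incl_den_def by (auto simp: init)
  have s: "((\<lambda>t. stretch t (pi/2)) has_real_derivative \<epsilon> * x' t) (at t)" for t
    unfolding stretch_def by (auto intro!: derivative_eq_intros derivs)
  have "((\<lambda>t. incl_num t (pi/2)) has_real_derivative 0) (at 0)"
    unfolding incl_num_def
    by (rule derivative_eq_intros s derivs refl)+ (simp add: init)
  moreover have "((\<lambda>t. incl_den t (pi/2)) has_real_derivative 0) (at 0)"
    unfolding incl_den_def
    by (rule derivative_eq_intros s derivs refl)+ (simp add: init)
  ultimately show ?thesis
    using d unfolding incl_rate_def by (auto intro!: derivative_eq_intros)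
qed

text \<open>Closed form of the turning rate \<open>incl_rate\<close> at \<open>t = 0\<close>, ready
  to be differentiated in \<open>\<theta>\<close>.\<close>

definition "rate \<theta> = - ((1 + 2 * a) / (1 + \<epsilon> * (1 + a) * sin \<theta>))"

lemma sin_half_pi_pos: "sin (pi/2) > (0::real)"
  by simp

lemma incl_zero: "incl 0 \<theta> = 0"
  by (simp add: incl_def init)

lemma incl_t_zero:
  assumes "sin \<theta> > 0"
  shows "incl_rate 0 \<theta> = rate \<theta>"
proof -
  have "stretch 0 \<theta> > 0" using stretch_pos[OF good(2) assms] .
  moreover have "1 + a \<noteq> 0" using a by simp
  moreover have "rate \<theta> = - ((1 + 2 * a) / stretch 0 \<theta>)"
    by (simp add: rate_def stretch_def init)
  ultimately show ?thesis
    by (simp add: incl_rate_def incl_num_def incl_den_def at_zero init power2_eq_square)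
qed

section \<open>First and second derivatives of the perturbed surface at the base point\<close>

abbreviation "base \<equiv> (0 :: real, pi/2 :: real)"

abbreviation "\<phi>\<^sub>t p \<equiv> fst (grad \<phi> p)"
abbreviation "\<phi>\<^sub>\<theta> p \<equiv> snd (grad \<phi> p)"

lemmas \<phi>_partials = has_real_derivative_partials[OF \<phi>(1)]
  has_real_derivative_partials[OF \<phi>(2)] has_real_derivative_partials[OF \<phi>(3)]

text \<open>The formula is given for all \<open>t\<close> near 0 so that it can be differentiated in
  \<open>t\<close> again. On this meridian the surface stays in a plane, and its normal is minus the
  unit vector at the angle \<open>\<epsilon> * z - incl\<close>.\<close>

lemma surf_t_meridian:
  assumes t: "t \<in> good"
  shows "d_t surf (t, pi/2) = vector [0,
    x' t * cos (\<epsilon> * z t) - (1 + \<epsilon> * x t) * dz t * sin (\<epsilon> * z t)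
      - \<phi>\<^sub>t (t, pi/2) * cos (\<epsilon> * z t - incl t (pi/2))
      + \<phi> (t, pi/2) * (\<epsilon> * dz t - incl_rate t (pi/2)) * sin (\<epsilon> * z t - incl t (pi/2)),
    x' t * sin (\<epsilon> * z t) + (1 + \<epsilon> * x t) * dz t * cos (\<epsilon> * z t)
      - \<phi>\<^sub>t (t, pi/2) * sin (\<epsilon> * z t - incl t (pi/2))
      - \<phi> (t, pi/2) * (\<epsilon> * dz t - incl_rate t (pi/2)) * cos (\<epsilon> * z t - incl t (pi/2))]"
  unfolding d_t_def prod.case
proof (rule vector_derivative_vector3[OF good(1) t])
  show "surf (s, pi/2) = vector [0,
     (1 / \<epsilon> + x s) * cos (\<epsilon> * z s) - \<phi> (s, pi/2) * cos (\<epsilon> * z s - incl s (pi/2)),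
     (1 / \<epsilon> + x s) * sin (\<epsilon> * z s) - \<phi> (s, pi/2) * sin (\<epsilon> * z s - incl s (pi/2))]"
    if "s \<in> good" for s
    using surf_eq[of s "pi/2"] stretch_pos[OF that, of "pi/2"] that
    by (simp add: good_def cos_diff sin_diff mult.commute)
  note D = derivative_eq_intros derivs \<phi>_partials incl_t[OF t sin_half_pi_pos] refl
  show "((\<lambda>s. (1 / \<epsilon> + x s) * cos (\<epsilon> * z s) - \<phi> (s, pi/2) * cos (\<epsilon> * z s - incl s (pi/2)))
    has_real_derivative
    x' t * cos (\<epsilon> * z t) - (1 + \<epsilon> * x t) * dz t * sin (\<epsilon> * z t)
      - \<phi>\<^sub>t (t, pi/2) * cos (\<epsilon> * z t - incl t (pi/2))
      + \<phi> (t, pi/2) * (\<epsilon> * dz t - incl_rate t (pi/2)) * sin (\<epsilon> * z t - incl t (pi/2))) (at t)"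
    apply (rule D)+
    apply simp
    using \<epsilon> by (simp add: algebra_simps)
  show "((\<lambda>s. (1 / \<epsilon> + x s) * sin (\<epsilon> * z s) - \<phi> (s, pi/2) * sin (\<epsilon> * z s - incl s (pi/2)))
    has_real_derivative
    x' t * sin (\<epsilon> * z t) + (1 + \<epsilon> * x t) * dz t * cos (\<epsilon> * z t)
      - \<phi>\<^sub>t (t, pi/2) * sin (\<epsilon> * z t - incl t (pi/2))
      - \<phi> (t, pi/2) * (\<epsilon> * dz t - incl_rate t (pi/2)) * cos (\<epsilon> * z t - incl t (pi/2))) (at t)"
    apply (rule D)+
    apply simp
    using \<epsilon> by (simp add: algebra_simps)
qed simp

text \<open>The speed at which the normal angle \<open>\<epsilon> * z - incl\<close> of the meridian
  turns at \<open>t = 0\<close>.\<close>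

definition "\<kappa> = \<epsilon> * (1 + a) - rate (pi/2)"

lemma surf_t_base:
  "d_t surf base = vector [0, - \<phi>\<^sub>t base, (1 + \<epsilon> * (1 + a)) * (1 + a) - \<phi> base * \<kappa>]"
  using incl_t_zero[of "pi/2"]
  by (simp add: surf_t_meridian[OF good(2)] at_zero init incl_zero \<kappa>_def)

lemma surf_tt_base:
  "d_t (d_t surf) base = vector [0,
    - ((1 + 2 * a) * (1 + a)) - (1 + \<epsilon> * (1 + a)) * (1 + a) * (\<epsilon> * (1 + a))
      - fst (grad (\<lambda>q. \<phi>\<^sub>t q) base) + \<phi> base * \<kappa>\<^sup>2,
    - 2 * \<phi>\<^sub>t base * \<kappa>]"
proof -
  note D = derivative_eq_intros derivs \<phi>_partials incl_t[OF good(2) sin_half_pi_pos] incl_rate_t refl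
  have r: "incl_rate 0 (pi/2) = rate (pi/2)"
    by (rule incl_t_zero) simp
  show ?thesis
    apply (subst d_t_def)
    unfolding prod.case
    apply (rule vector_derivative_vector3[OF good surf_t_meridian])
       apply assumption
      apply simp
     apply (rule D)+
     apply (simp add: at_zero init incl_zero r)
     apply (simp add: \<kappa>_def power2_eq_square algebra_simps)
    apply (rule D)+
    apply (simp add: at_zero init incl_zero r)
    apply (simp add: \<kappa>_def power2_eq_square algebra_simps)
    done
qed

text \<open>The counterpart at \<open>t = 0\<close> for \<open>\<theta>\<close> near
  \<open>pi/2\<close>, from which the mixed derivative is taken.\<close>

lemma surf_t_equator:
  assumes \<theta>: "sin \<theta> > 0"
  shows "d_t surf (0, \<theta>) = vector
    [- \<phi>\<^sub>t (0, \<theta>) * cos \<theta>, - \<phi>\<^sub>t (0, \<theta>) * sin \<theta>,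
     (1 + \<epsilon> * (1 + a) * sin \<theta>) * (1 + a)
       - \<phi> (0, \<theta>) * (\<epsilon> * (1 + a) * sin \<theta> - rate \<theta>)]"
proof -
  note D = derivative_eq_intros derivs \<phi>_partials incl_t[OF good(2) \<theta>] refl
  note r = incl_t_zero[OF \<theta>]
  have eq: "surf (s, \<theta>) = vector
    [(x s - \<phi> (s, \<theta>) * cos (incl s \<theta>)) * cos \<theta>,
     (1 / \<epsilon> + x s * sin \<theta>) * cos (\<epsilon> * z s)
       - \<phi> (s, \<theta>) * (cos (incl s \<theta>) * sin \<theta> * cos (\<epsilon> * z s) + sin (incl s \<theta>) * sin (\<epsilon> * z s)),
     (1 / \<epsilon> + x s * sin \<theta>) * sin (\<epsilon> * z s)
       - \<phi> (s, \<theta>) * (cos (incl s \<theta>) * sin \<theta> * sin (\<epsilon> * z s) - sin (incl s \<theta>) * cos (\<epsilon> * z s))]"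
    if "s \<in> good" for s
    using surf_eq stretch_pos[OF that \<theta>] that by (simp add: good_def)
  show ?thesis
    unfolding d_t_def prod.case
    apply (rule vector_derivative_vector3[OF good eq])
       apply assumption
      apply (rule D)+
      apply (simp add: at_zero init incl_zero)
     apply (rule D)+
     apply (simp add: at_zero init incl_zero)
    apply (rule D)+
    apply (simp add: at_zero init incl_zero r)
    using \<epsilon> apply (simp add: field_simps)
    done
qed

lemma surf_tth_base:
  "d_th (d_t surf) base = vector
    [\<phi>\<^sub>t base, - snd (grad (\<lambda>q. \<phi>\<^sub>t q) base), - \<phi>\<^sub>\<theta> base * \<kappa>]"
proof -
  have "1 + \<epsilon> * (1 + a) > 0" using \<epsilon> a by (simp add: add_pos_pos)
  \<comment> \<open>\<open>sin\<close> has its maximum at \<open>pi/2\<close>, so the turning rate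
    is stationary in \<open>\<theta>\<close> there.\<close>
  then have r: "(rate has_real_derivative 0) (at (pi/2))"
    unfolding rate_def by (auto intro!: derivative_eq_intros)
  note D = derivative_eq_intros \<phi>_partials r refl
  show ?thesis
    apply (subst d_th_def)
    unfolding prod.case
    apply (rule vector_derivative_vector3[OF open_sin_pos _ surf_t_equator])
        apply simp
       apply simp
      apply (rule D)+
      apply simp
     apply (rule D)+
     apply simp
    apply (rule D)+
    apply (simp add: \<kappa>_def)
    done
qed

lemma surf_equator:
  assumes "sin \<theta> > 0"
  shows "surf (0, \<theta>) = vector
    [(1 + a - \<phi> (0, \<theta>)) * cos \<theta>, 1 / \<epsilon> + (1 + a - \<phi> (0, \<theta>)) * sin \<theta>, 0]"
  using surf_eq[of 0 \<theta>] stretch_pos[OF good(2) assms] good(2)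
  by (simp add: good_def init incl_zero algebra_simps)

lemma surf_th_equator:
  assumes \<theta>: "sin \<theta> > 0"
  shows "d_th surf (0, \<theta>) = vector
    [- \<phi>\<^sub>\<theta> (0, \<theta>) * cos \<theta> - (1 + a - \<phi> (0, \<theta>)) * sin \<theta>,
     - \<phi>\<^sub>\<theta> (0, \<theta>) * sin \<theta> + (1 + a - \<phi> (0, \<theta>)) * cos \<theta>, 0]"
proof -
  note D = derivative_eq_intros \<phi>_partials refl
  show ?thesis
    apply (subst d_th_def)
    unfolding prod.case
    apply (rule vector_derivative_vector3[OF open_sin_pos _ surf_equator])
        apply (simp add: \<theta>)
       apply simp
      apply (rule D)+
      apply simp
     apply (rule D)+
     apply simp
    apply simp
    done
qed

lemma surf_thth_base:
  "d_th (d_th surf) base = vector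
    [2 * \<phi>\<^sub>\<theta> base, - snd (grad (\<lambda>q. \<phi>\<^sub>\<theta> q) base) - (1 + a - \<phi> base), 0]"
proof -
  note D = derivative_eq_intros \<phi>_partials refl
  show ?thesis
    apply (subst d_th_def)
    unfolding prod.case
    apply (rule vector_derivative_vector3[OF open_sin_pos _ surf_th_equator])
        apply simp
       apply simp
      apply (rule D)+
      apply simp
     apply (rule D)+
     apply simp
    apply simp
    done
qed

lemma surf_base: "surf base = vector [0, 1 / \<epsilon> + (1 + a - \<phi> base), 0]"
  using surf_equator[of "pi/2"] by simp

lemma surf_th_base: "d_th surf base = vector [- (1 + a - \<phi> base), - \<phi>\<^sub>\<theta> base, 0]"
  using surf_th_equator[of "pi/2"] by simp

end

section \<open>Expansion of the mean curvature\<close>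

text \<open>By Lagrange's identity the determinant of the first fundamental form is the squared
  length of the cross product. Multiplying out leaves a single irrational factor, the cube of that
  length; if the cross product vanishes, both sides are 0.\<close>

lemma mean_curvature_unnormalized:
  fixes X :: "real \<times> real \<Rightarrow> real^3"
  defines "c \<equiv> \<lambda>p. cross3 (d_t X p) (d_th X p)"
  shows "mean_curvature X p * (2 * norm (c p) ^ 3) =
    (norm (d_t X p))\<^sup>2 * (d_th (d_th X) p \<bullet> c p) - 2 * (d_t X p \<bullet> d_th X p) * (d_th (d_t X) p \<bullet> c p)
      + (norm (d_th X p))\<^sup>2 * (d_t (d_t X) p \<bullet> c p)"
proof (cases "c p = 0")
  case False
  define w where "w = norm (c p)"
  have "w > 0" using False by (simp add: w_def)
  have "(norm (d_t X p))\<^sup>2 * (norm (d_th X p))\<^sup>2 - (d_t X p \<bullet> d_th X p)\<^sup>2 = w\<^sup>2"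
    unfolding w_def c_def by (simp add: norm_cross)
  moreover have "unit_normal X p = c p /\<^sub>R w"
    by (simp add: unit_normal_def c_def w_def)
  ultimately show ?thesis
    using \<open>w > 0\<close> unfolding mean_curvature_def Let_def
    by (simp add: w_def[symmetric]) (simp add: field_simps power2_eq_square power3_eq_cube)
qed (simp add: c_def)

text \<open>The quantity \<open>\<kappa>\<close> of the locale, as an explicit function of
  \<open>a\<close> and \<open>\<epsilon>\<close>.\<close>

definition "defect_kappa a \<epsilon> = \<epsilon> * (1 + a) + (1 + 2 * a) / (1 + \<epsilon> * (1 + a))" for a \<epsilon> :: real

text \<open>The last component of \<open>d_t surf base\<close> is
  \<open>1 + a + \<delta> * \<sigma>\<close> with this \<open>\<sigma>\<close>.\<close>

definition "defect_sigma a \<delta> F \<eta> = \<eta> * (1 + a)\<^sup>2 - F * defect_kappa a (\<delta> * \<eta>)" for a \<delta> F \<eta> :: real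

text \<open>The second component of \<open>d_t (d_t surf) base\<close> is minus
  \<open>(1 + 2 * a) * (1 + a) + \<delta> * l\<close> with this \<open>l\<close>.\<close>

definition "defect_lambda a \<delta> F F\<^sub>1\<^sub>1 \<eta> =
  (1 + \<delta> * \<eta> * (1 + a)) * (1 + a)\<^sup>2 * \<eta> + F\<^sub>1\<^sub>1 - F * (defect_kappa a (\<delta> * \<eta>))\<^sup>2"
  for a \<delta> F F\<^sub>1\<^sub>1 \<eta> :: real

text \<open>
  The first-order part in \<open>\<delta>\<close> of the curvature equation at the base point, when the
  \<open>2\<close>-jet of the perturbation there is \<open>\<delta>\<close> times \<open>(F, F\<^sub>1, F\<^sub>2, F\<^sub>1\<^sub>1, F\<^sub>1\<^sub>2, F\<^sub>2\<^sub>2)\<close> and the bending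
  curvature is \<open>\<delta> * \<eta>\<close>. The part of order \<open>0\<close> cancels, since Delaunay surfaces have mean curvature \<open>1\<close>.
\<close>

definition defect :: "real \<Rightarrow> real \<Rightarrow> real \<Rightarrow> real \<Rightarrow> real \<Rightarrow> real \<Rightarrow> real \<Rightarrow> real \<Rightarrow> real \<Rightarrow> real" where
  "defect a \<delta> F F\<^sub>1 F\<^sub>2 F\<^sub>1\<^sub>1 F\<^sub>1\<^sub>2 F\<^sub>2\<^sub>2 \<eta> =
    (let \<kappa> = defect_kappa a (\<delta> * \<eta>); \<sigma> = defect_sigma a \<delta> F \<eta>; l = defect_lambda a \<delta> F F\<^sub>1\<^sub>1 \<eta>;
         S = 1 + a + \<delta> * \<sigma>; y = 1 + a - \<delta> * F
     in S ^ 3 * y * F\<^sub>2\<^sub>2 + S * y ^ 3 * l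
        + S * y\<^sup>2 * (2 * (1 + a)\<^sup>2 * F - F * (1 + 2 * a) * (1 + a) + (2 * (1 + a) * \<sigma> + \<delta> * \<sigma>\<^sup>2) * (1 - 2 * y))
        + \<delta> * (2 * S ^ 3 * F\<^sub>2\<^sup>2 + F\<^sub>1\<^sup>2 * (2 * S * (\<delta> * F\<^sub>2)\<^sup>2 + S * y * (\<delta> * F\<^sub>2\<^sub>2 + y))
            - 2 * F\<^sub>1 * F\<^sub>2 * (S * (\<delta> * F\<^sub>1) * (\<delta> * F\<^sub>2) + S * y * (\<delta> * F\<^sub>1\<^sub>2) + (\<delta> * F\<^sub>1) * (\<delta> * F\<^sub>2) * y * \<kappa>)
            + F\<^sub>2\<^sup>2 * (S * y * ((1 + 2 * a) * (1 + a) + \<delta> * l) + 2 * (\<delta> * F\<^sub>1)\<^sup>2 * y * \<kappa>)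
            + 2 * F\<^sub>1\<^sup>2 * y ^ 3 * \<kappa>))"

lemma defect_algebra:
  fixes a \<delta> F F\<^sub>1 F\<^sub>2 F\<^sub>1\<^sub>1 F\<^sub>1\<^sub>2 F\<^sub>2\<^sub>2 \<kappa> \<sigma> l :: real
  assumes S: "S = 1 + a + \<delta> * \<sigma>" and y: "y = 1 + a - \<delta> * F"
  shows "(S\<^sup>2 + (\<delta> * F\<^sub>1)\<^sup>2) * (2 * S * (\<delta> * F\<^sub>2)\<^sup>2 + S * y * (\<delta> * F\<^sub>2\<^sub>2 + y))
    - 2 * (\<delta> * F\<^sub>1 * (\<delta> * F\<^sub>2)) * (S * (\<delta> * F\<^sub>1) * (\<delta> * F\<^sub>2) + S * y * (\<delta> * F\<^sub>1\<^sub>2) + (\<delta> * F\<^sub>1) * (\<delta> * F\<^sub>2) * y * \<kappa>)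
    + (y\<^sup>2 + (\<delta> * F\<^sub>2)\<^sup>2) * (S * y * ((1 + 2 * a) * (1 + a) + \<delta> * l) + 2 * (\<delta> * F\<^sub>1)\<^sup>2 * y * \<kappa>)
    - 2 * (S * y) ^ 3
    = \<delta> * (S ^ 3 * y * F\<^sub>2\<^sub>2 + S * y ^ 3 * l
        + S * y\<^sup>2 * (2 * (1 + a)\<^sup>2 * F - F * (1 + 2 * a) * (1 + a) + (2 * (1 + a) * \<sigma> + \<delta> * \<sigma>\<^sup>2) * (1 - 2 * y))
        + \<delta> * (2 * S ^ 3 * F\<^sub>2\<^sup>2 + F\<^sub>1\<^sup>2 * (2 * S * (\<delta> * F\<^sub>2)\<^sup>2 + S * y * (\<delta> * F\<^sub>2\<^sub>2 + y))
            - 2 * F\<^sub>1 * F\<^sub>2 * (S * (\<delta> * F\<^sub>1) * (\<delta> * F\<^sub>2) + S * y * (\<delta> * F\<^sub>1\<^sub>2) + (\<delta> * F\<^sub>1) * (\<delta> * F\<^sub>2) * y * \<kappa>)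
            + F\<^sub>2\<^sup>2 * (S * y * ((1 + 2 * a) * (1 + a) + \<delta> * l) + 2 * (\<delta> * F\<^sub>1)\<^sup>2 * y * \<kappa>)
            + 2 * F\<^sub>1\<^sup>2 * y ^ 3 * \<kappa>))"
proof -
  \<comment> \<open>The only place where divisibility by \<open>\<delta>\<close> is not evident: at
    \<open>\<delta> = 0\<close> the right-hand side is zero because the Delaunay surface has mean
    curvature 1. The remaining terms carry \<open>\<delta>\<close> explicitly.\<close>
  have "\<delta> * (2 * (1 + a)\<^sup>2 * F - F * (1 + 2 * a) * (1 + a) + (2 * (1 + a) * \<sigma> + \<delta> * \<sigma>\<^sup>2) * (1 - 2 * y))
      = S\<^sup>2 + y * (1 + 2 * a) * (1 + a) - 2 * S\<^sup>2 * y"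
    unfolding S y by (simp add: algebra_simps power2_eq_square)
  then show ?thesis by algebra
qed

text \<open>The constant part 1 of the curvature contributes twice the cube of the area factor
  \<open>W\<close>, at least the \<open>2 * (S * y) ^ 3\<close> subtracted in
  \<open>defect_algebra\<close>. Dividing by \<open>\<delta>\<close> leaves the error
  \<open>e\<close> against the defect.\<close>

lemma (in bent_delaunay) defect_ge:
  assumes \<delta>: "\<delta> > 0" and scale: "\<phi> base = \<delta> * F" "\<phi>\<^sub>t base = \<delta> * F\<^sub>1" "\<phi>\<^sub>\<theta> base = \<delta> * F\<^sub>2"
      "fst (grad (\<lambda>q. \<phi>\<^sub>t q) base) = \<delta> * F\<^sub>1\<^sub>1" "snd (grad (\<lambda>q. \<phi>\<^sub>t q) base) = \<delta> * F\<^sub>1\<^sub>2"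
      "snd (grad (\<lambda>q. \<phi>\<^sub>\<theta> q) base) = \<delta> * F\<^sub>2\<^sub>2" "\<epsilon> = \<delta> * \<eta>"
    and S: "S = 1 + a + \<delta> * defect_sigma a \<delta> F \<eta>" "S > 0" and y: "y = 1 + a - \<delta> * F" "y > 0"
    and H: "mean_curvature surf base = 1 + \<delta> * e"
  shows "2 * sqrt ((S * (\<delta> * F\<^sub>2))\<^sup>2 + (S * y)\<^sup>2 + (\<delta> * F\<^sub>1 * y)\<^sup>2) ^ 3 * e
    \<le> defect a \<delta> F F\<^sub>1 F\<^sub>2 F\<^sub>1\<^sub>1 F\<^sub>1\<^sub>2 F\<^sub>2\<^sub>2 \<eta>"
proof -
  define l where "l = defect_lambda a \<delta> F F\<^sub>1\<^sub>1 \<eta>"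
  have \<kappa>: "\<kappa> = defect_kappa a (\<delta> * \<eta>)"
    unfolding \<kappa>_def rate_def defect_kappa_def scale(7)[symmetric] by simp
  have St: "(1 + \<epsilon> * (1 + a)) * (1 + a) - \<phi> base * \<kappa> = S"
    unfolding S(1) defect_sigma_def scale \<kappa>[symmetric] by (simp add: algebra_simps power2_eq_square)
  have l: "(1 + 2 * a) * (1 + a) + (1 + \<epsilon> * (1 + a)) * (1 + a) * (\<epsilon> * (1 + a)) + \<delta> * F\<^sub>1\<^sub>1 - \<phi> base * \<kappa>\<^sup>2
     = (1 + 2 * a) * (1 + a) + \<delta> * l"
    unfolding l_def defect_lambda_def scale \<kappa>[symmetric] by (simp add: algebra_simps power2_eq_square)
  have tt: "d_t (d_t surf) base = vector [0, - ((1 + 2 * a) * (1 + a) + \<delta> * l), - 2 * (\<delta> * F\<^sub>1) * \<kappa>]"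
    unfolding surf_tt_base l[symmetric] by (simp add: scale algebra_simps)
  have t: "d_t surf base = vector [0, - (\<delta> * F\<^sub>1), S]"
    unfolding surf_t_base St by (simp add: scale)
  have th: "d_th surf base = vector [- y, - (\<delta> * F\<^sub>2), 0]"
    unfolding surf_th_base by (simp add: scale y(1))
  have tth: "d_th (d_t surf) base = vector [\<delta> * F\<^sub>1, - (\<delta> * F\<^sub>1\<^sub>2), - (\<delta> * F\<^sub>2) * \<kappa>]"
    unfolding surf_tth_base by (simp add: scale)
  have thth: "d_th (d_th surf) base = vector [2 * (\<delta> * F\<^sub>2), - (\<delta> * F\<^sub>2\<^sub>2) - y, 0]"
    unfolding surf_thth_base by (simp add: scale y(1))
  have c: "cross3 (d_t surf base) (d_th surf base) = vector [S * (\<delta> * F\<^sub>2), - (S * y), - (\<delta> * F\<^sub>1 * y)]"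
    unfolding t th by (simp add: cross3_def vec_eq_iff forall_3)
  define W where "W = norm (cross3 (d_t surf base) (d_th surf base))"
  have W: "W = sqrt ((S * (\<delta> * F\<^sub>2))\<^sup>2 + (S * y)\<^sup>2 + (\<delta> * F\<^sub>1 * y)\<^sup>2)"
    unfolding W_def c by (simp add: norm_vec_def L2_set_def sum_3)
  \<comment> \<open>This one-sided bound keeps the square root out of the expansion.\<close>
  have "S * y \<le> W" unfolding W by (rule real_le_rsqrt) simp
  then have W3: "(S * y) ^ 3 \<le> W ^ 3" using S(2) y(2) by (intro power_mono) auto
  have Et: "(norm (vector [0, - (\<delta> * F\<^sub>1), S] :: real^3))\<^sup>2 = S\<^sup>2 + (\<delta> * F\<^sub>1)\<^sup>2"
    by (simp add: norm_vec_def L2_set_def sum_3)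
  have Gt: "(norm (vector [- y, - (\<delta> * F\<^sub>2), 0] :: real^3))\<^sup>2 = y\<^sup>2 + (\<delta> * F\<^sub>2)\<^sup>2"
    by (simp add: norm_vec_def L2_set_def sum_3)
  have "(1 + \<delta> * e) * (2 * W ^ 3) =
      (S\<^sup>2 + (\<delta> * F\<^sub>1)\<^sup>2) * (2 * S * (\<delta> * F\<^sub>2)\<^sup>2 + S * y * (\<delta> * F\<^sub>2\<^sub>2 + y))
    - 2 * (\<delta> * F\<^sub>1 * (\<delta> * F\<^sub>2)) * (S * (\<delta> * F\<^sub>1) * (\<delta> * F\<^sub>2) + S * y * (\<delta> * F\<^sub>1\<^sub>2) + (\<delta> * F\<^sub>1) * (\<delta> * F\<^sub>2) * y * \<kappa>)
    + (y\<^sup>2 + (\<delta> * F\<^sub>2)\<^sup>2) * (S * y * ((1 + 2 * a) * (1 + a) + \<delta> * l) + 2 * (\<delta> * F\<^sub>1)\<^sup>2 * y * \<kappa>)"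
  proof -
    have i1: "d_th (d_th surf) base \<bullet> cross3 (d_t surf base) (d_th surf base)
        = 2 * S * (\<delta> * F\<^sub>2)\<^sup>2 + S * y * (\<delta> * F\<^sub>2\<^sub>2 + y)"
      unfolding thth c by (simp add: inner_vec_def sum_3) (simp add: algebra_simps power2_eq_square)
    have i2: "d_th (d_t surf) base \<bullet> cross3 (d_t surf base) (d_th surf base)
        = S * (\<delta> * F\<^sub>1) * (\<delta> * F\<^sub>2) + S * y * (\<delta> * F\<^sub>1\<^sub>2) + (\<delta> * F\<^sub>1) * (\<delta> * F\<^sub>2) * y * \<kappa>"
      unfolding tth c by (simp add: inner_vec_def sum_3)
    have i3: "d_t (d_t surf) base \<bullet> cross3 (d_t surf base) (d_th surf base)
        = S * y * ((1 + 2 * a) * (1 + a) + \<delta> * l) + 2 * (\<delta> * F\<^sub>1)\<^sup>2 * y * \<kappa>"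
      unfolding tt c by (simp add: inner_vec_def sum_3) (simp add: algebra_simps power2_eq_square)
    have i4: "d_t surf base \<bullet> d_th surf base = \<delta> * F\<^sub>1 * (\<delta> * F\<^sub>2)"
      unfolding t th by (simp add: inner_vec_def sum_3)
    show ?thesis
      using mean_curvature_unnormalized[of surf base]
      unfolding i1 i2 i3 i4 W_def[symmetric] H unfolding t th Et Gt .
  qed
  then have "(1 + \<delta> * e) * (2 * W ^ 3) - 2 * (S * y) ^ 3 = \<delta> * defect a \<delta> F F\<^sub>1 F\<^sub>2 F\<^sub>1\<^sub>1 F\<^sub>1\<^sub>2 F\<^sub>2\<^sub>2 \<eta>"
    unfolding defect_def Let_def \<kappa>[symmetric] l_def[symmetric] S(1)[symmetric] y(1)[symmetric]
    using defect_algebra[OF S(1) y(1), of F\<^sub>1 F\<^sub>2 F\<^sub>2\<^sub>2 F\<^sub>1\<^sub>2 \<kappa> l] by (simp only:)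
  moreover have "(1 + \<delta> * e) * (2 * W ^ 3) = 2 * W ^ 3 + \<delta> * (2 * W ^ 3 * e)"
    by (simp only: distrib_right mult_1 mult.assoc mult.left_commute[of e] mult.commute[of e])
  ultimately have "\<delta> * (2 * W ^ 3 * e) \<le> \<delta> * defect a \<delta> F F\<^sub>1 F\<^sub>2 F\<^sub>1\<^sub>1 F\<^sub>1\<^sub>2 F\<^sub>2\<^sub>2 \<eta>"
    using W3 by linarith
  then show ?thesis using \<delta> unfolding W by simp
qed

section \<open>Passing to the limit along the sequence\<close>

lemma defect_sigma_tendsto:
  assumes "a \<longlonglongrightarrow> 0" "\<delta> \<longlonglongrightarrow> 0" "F \<longlonglongrightarrow> f" "\<eta> \<longlonglongrightarrow> \<eta>'"
  shows "(\<lambda>k. defect_kappa (a k) (\<delta> k * \<eta> k)) \<longlonglongrightarrow> 1"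
    and "(\<lambda>k. defect_sigma (a k) (\<delta> k) (F k) (\<eta> k)) \<longlonglongrightarrow> \<eta>' - f"
    and "(\<lambda>k. 1 + a k + \<delta> k * defect_sigma (a k) (\<delta> k) (F k) (\<eta> k)) \<longlonglongrightarrow> 1"
proof -
  show \<kappa>: "(\<lambda>k. defect_kappa (a k) (\<delta> k * \<eta> k)) \<longlonglongrightarrow> 1"
    unfolding defect_kappa_def by (rule tendsto_eq_intros assms refl | simp)+
  show \<sigma>: "(\<lambda>k. defect_sigma (a k) (\<delta> k) (F k) (\<eta> k)) \<longlonglongrightarrow> \<eta>' - f"
    unfolding defect_sigma_def by (rule tendsto_eq_intros assms \<kappa> refl | simp)+
  show "(\<lambda>k. 1 + a k + \<delta> k * defect_sigma (a k) (\<delta> k) (F k) (\<eta> k)) \<longlonglongrightarrow> 1"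
    by (rule tendsto_eq_intros assms \<sigma> refl | simp)+
qed

text \<open>As \<open>a\<close> tends to 0 the curve near \<open>t = 0\<close> becomes that of the
  unit sphere. The limit is the sphere's Jacobi operator, Laplacian plus 2, applied to the
  perturbation at the equator, minus the effect of bending.\<close>

lemma defect_tendsto:
  assumes lims: "a \<longlonglongrightarrow> 0" "\<delta> \<longlonglongrightarrow> 0" "F \<longlonglongrightarrow> f" "F\<^sub>1 \<longlonglongrightarrow> f\<^sub>1" "F\<^sub>2 \<longlonglongrightarrow> f\<^sub>2"
    "F\<^sub>1\<^sub>1 \<longlonglongrightarrow> f\<^sub>1\<^sub>1" "F\<^sub>1\<^sub>2 \<longlonglongrightarrow> f\<^sub>1\<^sub>2" "F\<^sub>2\<^sub>2 \<longlonglongrightarrow> f\<^sub>2\<^sub>2" "\<eta> \<longlonglongrightarrow> \<eta>'"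
  shows "(\<lambda>k. defect (a k) (\<delta> k) (F k) (F\<^sub>1 k) (F\<^sub>2 k) (F\<^sub>1\<^sub>1 k) (F\<^sub>1\<^sub>2 k) (F\<^sub>2\<^sub>2 k) (\<eta> k))
    \<longlonglongrightarrow> f\<^sub>1\<^sub>1 + f\<^sub>2\<^sub>2 + 2 * f - \<eta>'"
proof -
  note sig = defect_sigma_tendsto[OF lims(1-3,9)]
  have l: "(\<lambda>k. defect_lambda (a k) (\<delta> k) (F k) (F\<^sub>1\<^sub>1 k) (\<eta> k)) \<longlonglongrightarrow> \<eta>' + f\<^sub>1\<^sub>1 - f"
    unfolding defect_lambda_def by (rule tendsto_eq_intros lims sig refl | simp)+
  have y: "(\<lambda>k. 1 + a k - \<delta> k * F k) \<longlonglongrightarrow> 1"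
    by (rule tendsto_eq_intros lims refl | simp)+
  define S where "S k = 1 + a k + \<delta> k * defect_sigma (a k) (\<delta> k) (F k) (\<eta> k)" for k
  define y where "y k = 1 + a k - \<delta> k * F k" for k
  have S': "S \<longlonglongrightarrow> 1" using sig(3) by (simp add: S_def[abs_def])
  have y': "y \<longlonglongrightarrow> 1" using y by (simp add: y_def[abs_def])
  note L = tendsto_intros lims sig l S' y'
  show ?thesis
    unfolding defect_def Let_def S_def[symmetric] y_def[symmetric]
    by (rule tendsto_eq_rhs, (rule L)+) (simp add: algebra_simps)
qed

text \<open>\<open>S\<close> and \<open>y\<close> tend to 1, so they are eventually positive and
  \<open>defect_ge\<close> applies; its left-hand side tends to 0 with \<open>e\<close>.\<close>

lemma defect_limit_nonneg:
  fixes a \<delta> F F\<^sub>1 F\<^sub>2 F\<^sub>1\<^sub>1 F\<^sub>1\<^sub>2 F\<^sub>2\<^sub>2 \<eta> e :: "nat \<Rightarrow> real"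
  assumes loc: "\<And>k. bent_delaunay (a k) (\<delta> k * \<eta> k) (x k) (x' k) (z k) (\<phi> k)"
    and lims: "a \<longlonglongrightarrow> 0" "\<delta> \<longlonglongrightarrow> 0" "F \<longlonglongrightarrow> f" "F\<^sub>1 \<longlonglongrightarrow> f\<^sub>1" "F\<^sub>2 \<longlonglongrightarrow> f\<^sub>2"
    "F\<^sub>1\<^sub>1 \<longlonglongrightarrow> f\<^sub>1\<^sub>1" "F\<^sub>1\<^sub>2 \<longlonglongrightarrow> f\<^sub>1\<^sub>2" "F\<^sub>2\<^sub>2 \<longlonglongrightarrow> f\<^sub>2\<^sub>2" "\<eta> \<longlonglongrightarrow> \<eta>'" and e: "e \<longlonglongrightarrow> 0"
    and \<delta>: "\<And>k. \<delta> k > 0"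
    and scale: "\<And>k. \<phi> k (0, pi/2) = \<delta> k * F k" "\<And>k. fst (grad (\<phi> k) (0, pi/2)) = \<delta> k * F\<^sub>1 k"
      "\<And>k. snd (grad (\<phi> k) (0, pi/2)) = \<delta> k * F\<^sub>2 k"
      "\<And>k. fst (grad (\<lambda>q. fst (grad (\<phi> k) q)) (0, pi/2)) = \<delta> k * F\<^sub>1\<^sub>1 k"
      "\<And>k. snd (grad (\<lambda>q. fst (grad (\<phi> k) q)) (0, pi/2)) = \<delta> k * F\<^sub>1\<^sub>2 k"
      "\<And>k. snd (grad (\<lambda>q. snd (grad (\<phi> k) q)) (0, pi/2)) = \<delta> k * F\<^sub>2\<^sub>2 k"
    and H: "\<And>k. mean_curvature (bent_delaunay.surf (\<delta> k * \<eta> k) (x k) (z k) (\<phi> k)) (0, pi/2) = 1 + \<delta> k * e k"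
  shows "\<eta>' \<le> f\<^sub>1\<^sub>1 + f\<^sub>2\<^sub>2 + 2 * f"
proof -
  define S where "S k = 1 + a k + \<delta> k * defect_sigma (a k) (\<delta> k) (F k) (\<eta> k)" for k
  define y where "y k = 1 + a k - \<delta> k * F k" for k
  have S: "S \<longlonglongrightarrow> 1"
    using defect_sigma_tendsto(3)[OF lims(1-3,9)] by (simp add: S_def[abs_def])
  have y: "y \<longlonglongrightarrow> 1"
    unfolding y_def[abs_def] by (rule tendsto_eq_intros lims refl | simp)+
  have "(\<lambda>k. 2 * sqrt ((S k * (\<delta> k * F\<^sub>2 k))\<^sup>2 + (S k * y k)\<^sup>2 + (\<delta> k * F\<^sub>1 k * y k)\<^sup>2) ^ 3 * e k) \<longlonglongrightarrow> 0"
    by (rule tendsto_eq_rhs, (rule tendsto_intros S y lims e)+) simp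
  moreover have "\<forall>\<^sub>F k in sequentially.
    2 * sqrt ((S k * (\<delta> k * F\<^sub>2 k))\<^sup>2 + (S k * y k)\<^sup>2 + (\<delta> k * F\<^sub>1 k * y k)\<^sup>2) ^ 3 * e k
    \<le> defect (a k) (\<delta> k) (F k) (F\<^sub>1 k) (F\<^sub>2 k) (F\<^sub>1\<^sub>1 k) (F\<^sub>1\<^sub>2 k) (F\<^sub>2\<^sub>2 k) (\<eta> k)"
    using order_tendstoD(1)[OF S zero_less_one] order_tendstoD(1)[OF y zero_less_one]
    by eventually_elim
      (rule bent_delaunay.defect_ge[OF loc \<delta> scale refl S_def _ y_def _ H])
  ultimately have "0 \<le> f\<^sub>1\<^sub>1 + f\<^sub>2\<^sub>2 + 2 * f - \<eta>'"
    using defect_tendsto[OF lims] tendsto_le[OF trivial_limit_sequentially] by blast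
  then show ?thesis by simp
qed

text \<open>Compactness of a seven-dimensional box yields one common subsequence at once.\<close>

lemma bounded_tuple_convergent_subsequence:
  fixes f\<^sub>1 f\<^sub>2 f\<^sub>3 f\<^sub>4 f\<^sub>5 f\<^sub>6 f\<^sub>7 :: "nat \<Rightarrow> real"
  assumes "\<And>k. \<bar>f\<^sub>1 k\<bar> \<le> B" "\<And>k. \<bar>f\<^sub>2 k\<bar> \<le> B" "\<And>k. \<bar>f\<^sub>3 k\<bar> \<le> B" "\<And>k. \<bar>f\<^sub>4 k\<bar> \<le> B"
    "\<And>k. \<bar>f\<^sub>5 k\<bar> \<le> B" "\<And>k. \<bar>f\<^sub>6 k\<bar> \<le> B" "\<And>k. \<bar>f\<^sub>7 k\<bar> \<le> B"
  obtains r l\<^sub>1 l\<^sub>2 l\<^sub>3 l\<^sub>4 l\<^sub>5 l\<^sub>6 l\<^sub>7 where "strict_mono (r :: nat \<Rightarrow> nat)"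
    "(f\<^sub>1 \<circ> r) \<longlonglongrightarrow> l\<^sub>1" "(f\<^sub>2 \<circ> r) \<longlonglongrightarrow> l\<^sub>2" "(f\<^sub>3 \<circ> r) \<longlonglongrightarrow> l\<^sub>3" "(f\<^sub>4 \<circ> r) \<longlonglongrightarrow> l\<^sub>4"
    "(f\<^sub>5 \<circ> r) \<longlonglongrightarrow> l\<^sub>5" "(f\<^sub>6 \<circ> r) \<longlonglongrightarrow> l\<^sub>6" "(f\<^sub>7 \<circ> r) \<longlonglongrightarrow> l\<^sub>7"
proof -
  define v where "v k = (f\<^sub>1 k, f\<^sub>2 k, f\<^sub>3 k, f\<^sub>4 k, f\<^sub>5 k, f\<^sub>6 k, f\<^sub>7 k)" for k
  let ?I = "{- B..B}"
  have "compact (?I \<times> ?I \<times> ?I \<times> ?I \<times> ?I \<times> ?I \<times> ?I)"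
    by (intro compact_Times compact_Icc)
  moreover have "\<forall>k. v k \<in> ?I \<times> ?I \<times> ?I \<times> ?I \<times> ?I \<times> ?I \<times> ?I"
    using assms by (simp add: v_def abs_le_iff minus_le_iff)
  ultimately obtain l r where r: "strict_mono (r :: nat \<Rightarrow> nat)" and v: "(v \<circ> r) \<longlonglongrightarrow> l"
    by (metis compact_def)
  have 1: "(f\<^sub>1 \<circ> r) \<longlonglongrightarrow> fst l"
    using tendsto_fst[OF v] by (simp add: v_def comp_def)
  note v = tendsto_snd[OF v]
  have 2: "(f\<^sub>2 \<circ> r) \<longlonglongrightarrow> fst (snd l)"
    using tendsto_fst[OF v] by (simp add: v_def comp_def)
  note v = tendsto_snd[OF v]
  have 3: "(f\<^sub>3 \<circ> r) \<longlonglongrightarrow> fst (snd (snd l))"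
    using tendsto_fst[OF v] by (simp add: v_def comp_def)
  note v = tendsto_snd[OF v]
  have 4: "(f\<^sub>4 \<circ> r) \<longlonglongrightarrow> fst (snd (snd (snd l)))"
    using tendsto_fst[OF v] by (simp add: v_def comp_def)
  note v = tendsto_snd[OF v]
  have 5: "(f\<^sub>5 \<circ> r) \<longlonglongrightarrow> fst (snd (snd (snd (snd l))))"
    using tendsto_fst[OF v] by (simp add: v_def comp_def)
  note v = tendsto_snd[OF v]
  have 6: "(f\<^sub>6 \<circ> r) \<longlonglongrightarrow> fst (snd (snd (snd (snd (snd l)))))"
    using tendsto_fst[OF v] by (simp add: v_def comp_def)
  have 7: "(f\<^sub>7 \<circ> r) \<longlonglongrightarrow> snd (snd (snd (snd (snd (snd l)))))"
    using tendsto_snd[OF v] by (simp add: v_def comp_def)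
  show ?thesis by (rule that[OF r 1 2 3 4 5 6 7])
qed

text \<open>The points lie on one ray at distance at least of order \<open>n\<close>, so
  \<open>A\<close> enters through the fixed value \<open>A v\<close>, and the deviation of
  \<open>H\<close> from 1 is of order \<open>n powr (- \<beta>)\<close>. Multiplied by
  \<open>n\<close> it still tends to 0, as \<open>\<beta> > 1\<close>.\<close>

lemma curvature_decay:
  fixes H A :: "real^3 \<Rightarrow> real" and n s :: "nat \<Rightarrow> real"
  assumes "\<beta> > 1" "\<nu> > 0"
    and O: "(\<lambda>X. H X - (1 + A (X /\<^sub>R norm X) / norm X powr \<beta>))
           \<in> O[at_infinity](\<lambda>X. 1 / norm X powr (\<beta> + \<nu>))"
    and n: "filterlim n at_top sequentially" and c: "c > 0" and s: "\<And>k. s k \<ge> c * n k"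
  shows "(\<lambda>k. n k * (H (vector [0, s k, 0]) - 1)) \<longlonglongrightarrow> 0"
proof -
  let ?X = "\<lambda>k. vector [0, s k, 0] :: real^3"
  have norm_X: "norm (?X k) = \<bar>s k\<bar>" for k
    by (simp add: norm_vec_def L2_set_def sum_3)
  have s_top: "filterlim s at_top sequentially"
  proof (rule filterlim_at_top_mono)
    show "filterlim (\<lambda>k. c * n k) at_top sequentially"
      by (rule filterlim_tendsto_pos_mult_at_top[OF tendsto_const c n])
  qed (simp add: s)
  have inf: "filterlim ?X at_infinity sequentially"
    unfolding filterlim_at_infinity_conv_norm_at_top norm_X
    by (rule filterlim_at_top_mono[OF s_top]) (intro always_eventually allI abs_ge_self)
  obtain C where C: "\<forall>\<^sub>F X in at_infinity. norm (H X - (1 + A (X /\<^sub>R norm X) / norm X powr \<beta>))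
      \<le> C * norm (1 / norm X powr (\<beta> + \<nu>))"
    using O by (elim landau_o.bigE)
  define v where "v = (vector [0, 1, 0] :: real^3)"
  define D where "D = \<bar>A v\<bar> + \<bar>C\<bar>"
  have bound: "\<forall>\<^sub>F k in sequentially. norm (n k * (H (?X k) - 1)) \<le> D * c powr (- \<beta>) * n k powr (1 - \<beta>)"
    using eventually_compose_filterlim[OF C inf] filterlim_at_top_dense[THEN iffD1, OF s_top, rule_format, of 1]
      filterlim_at_top_dense[THEN iffD1, OF n, rule_format, of 0]
  proof eventually_elim
    case (elim k)
    have X: "?X k /\<^sub>R \<bar>s k\<bar> = v"
      using elim by (simp add: v_def vec_eq_iff forall_3)
    have "\<bar>H (?X k) - 1 - A v / s k powr \<beta>\<bar> \<le> C * (1 / s k powr (\<beta> + \<nu>))"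
      using elim unfolding norm_X X by (simp add: algebra_simps)
    also have "\<dots> \<le> \<bar>C\<bar> * (1 / s k powr \<beta>)"
      using elim \<open>\<nu> > 0\<close> by (intro mult_mono frac_le powr_mono) auto
    finally have "\<bar>H (?X k) - 1\<bar> \<le> \<bar>A v / s k powr \<beta>\<bar> + \<bar>C\<bar> * (1 / s k powr \<beta>)"
      by linarith
    also have "\<dots> = D * s k powr (- \<beta>)"
      by (simp add: D_def powr_minus_divide add_divide_distrib)
    also have "\<dots> \<le> D * (c * n k) powr (- \<beta>)"
      using elim c \<open>\<beta> > 1\<close> s[of k] by (intro mult_left_mono powr_mono2') (auto simp: D_def)
    finally have "n k * \<bar>H (?X k) - 1\<bar> \<le> n k * (D * (c * n k) powr (- \<beta>))"
      using elim by (intro mult_left_mono) auto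
    also have "\<dots> = D * c powr (- \<beta>) * (n k * n k powr (- \<beta>))"
      using elim c by (simp add: powr_mult)
    also have "n k * n k powr (- \<beta>) = n k powr (1 - \<beta>)"
      using elim by (simp add: powr_diff powr_minus divide_inverse)
    finally show ?case using elim by (simp add: abs_mult)
  qed
  have "(\<lambda>k. n k powr (1 - \<beta>)) \<longlonglongrightarrow> 0"
    using tendsto_neg_powr[of "1 - \<beta>" n sequentially] n \<open>\<beta> > 1\<close> by simp
  then have "(\<lambda>k. D * c powr (- \<beta>) * n k powr (1 - \<beta>)) \<longlonglongrightarrow> 0"
    by (rule tendsto_mult_right_zero)
  then show ?thesis
    using bound by (rule Lim_null_comparison[rotated])
qed

section \<open>Nonexistence\<close>

lemma weighted_C2_norm_bound:
  assumes "weighted_C2_norm K x \<phi> \<le> ereal r" "p \<in> K" "x (fst p) > 0"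
  shows "\<bar>\<phi> p\<bar> + norm (grad \<phi> p) + norm (hessian \<phi> p) \<le> r * x (fst p)"
proof -
  have "ereal (inverse (x (fst p)) * (\<bar>\<phi> p\<bar> + norm (grad \<phi> p) + norm (hessian \<phi> p))) \<le> ereal r"
    using SUP_upper[OF assms(2)] assms(1) unfolding weighted_C2_norm_def by (rule order_trans)
  then show ?thesis using assms(3) by (simp add: field_simps)
qed

theorem theorem1p2:
  fixes x z :: "real \<Rightarrow> real \<Rightarrow> real" and \<tau> h :: "real \<Rightarrow> real"
    and H A :: "real^3 \<Rightarrow> real" and \<beta> \<nu> :: real
  assumes delaunay: "\<And>a. a \<in> {- 1/2..} - {0} \<Longrightarrow> delaunay a (x a) (z a) (\<tau> a) (h a)"
    and "C1_on UNIV H"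
    and "C1_sphere A" and "\<beta> > 1" and "\<nu> > 0"
    and "(\<lambda>X. H X - (1 + A (X /\<^sub>R norm X) / norm X powr \<beta>))
           \<in> O[at_infinity](\<lambda>X. 1 / norm X powr (\<beta> + \<nu>))"
    and "Limsup at_infinity (\<lambda>X. ereal (norm X powr (\<beta> + 1) * norm (grad H X))) < \<infinity>"
  shows "\<not> (\<exists>(\<alpha>::real) (a :: nat \<Rightarrow> real) (n :: nat \<Rightarrow> nat)
             (\<phi> :: nat \<Rightarrow> real \<times> real \<Rightarrow> real) (R\<^sub>1::real) (R::real).
      0 < \<alpha> \<and> \<alpha> \<le> 1 \<and>
      (\<forall>k. a k \<in> {- 1/2..} - {0}) \<and> (\<forall>k. n k > 0) \<and> (\<forall>k. C2_holder \<alpha> (\<phi> k)) \<and>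
      a \<longlonglongrightarrow> 0 \<and> filterlim n at_top sequentially \<and>
      0 < R\<^sub>1 \<and> R\<^sub>1 < pi / (2 + sqrt 2) \<and> 0 < R \<and>
      (\<forall>k t \<theta>. \<phi> k (t + 2 * real (n k) * \<tau> (a k), \<theta>) = \<phi> k (t, \<theta>) \<and>
               \<phi> k (t, \<theta> + 2 * pi) = \<phi> k (t, \<theta>)) \<and>
      (\<forall>k. weighted_C2_norm (period_rect (n k) (\<tau> (a k))) (x (a k)) (\<phi> k) \<le> ereal (R\<^sub>1 / n k)) \<and>
      (\<forall>k. holder_const \<alpha> (period_rect (n k) (\<tau> (a k))) (hessian (\<phi> k)) \<le> ereal (R / n k)) \<and>
      (\<forall>k. let X = delaunay_torus (n k) (h (a k)) (x (a k)) (z (a k));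
               Y = (\<lambda>p. X p + \<phi> k p *\<^sub>R unit_normal X p)
           in \<forall>p. regular_at Y p \<and> mean_curvature Y p = H (Y p)))"
proof (rule notI, elim exE conjE)
  fix \<alpha> R\<^sub>1 R :: real and a\<^sub>0 :: "nat \<Rightarrow> real" and n\<^sub>0 :: "nat \<Rightarrow> nat" and \<phi>\<^sub>0 :: "nat \<Rightarrow> real \<times> real \<Rightarrow> real"
  assume a\<^sub>0: "\<forall>k. a\<^sub>0 k \<in> {- 1/2..} - {0}" and n\<^sub>0: "\<forall>k. n\<^sub>0 k > 0" and \<phi>\<^sub>0: "\<forall>k. C2_holder \<alpha> (\<phi>\<^sub>0 k)"
    and lim\<^sub>0: "a\<^sub>0 \<longlonglongrightarrow> 0" "filterlim n\<^sub>0 at_top sequentially"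
    and R\<^sub>1: "0 < R\<^sub>1" "R\<^sub>1 < pi / (2 + sqrt 2)"
    and norm\<^sub>0: "\<forall>k. weighted_C2_norm (period_rect (n\<^sub>0 k) (\<tau> (a\<^sub>0 k))) (x (a\<^sub>0 k)) (\<phi>\<^sub>0 k) \<le> ereal (R\<^sub>1 / n\<^sub>0 k)"
    and curv\<^sub>0: "\<forall>k. let X = delaunay_torus (n\<^sub>0 k) (h (a\<^sub>0 k)) (x (a\<^sub>0 k)) (z (a\<^sub>0 k));
               Y = (\<lambda>p. X p + \<phi>\<^sub>0 k p *\<^sub>R unit_normal X p)
           in \<forall>p. regular_at Y p \<and> mean_curvature Y p = H (Y p)"
  \<comment> \<open>Dropping finitely many terms brings every \<open>a k\<close> into the range of
    \<open>delaunay_height_ge\<close> and away from \<open>- 1/2\<close>.\<close>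
  have "\<forall>\<^sub>F k in sequentially. \<bar>a\<^sub>0 k\<bar> < 1/200"
    using order_tendstoD(2)[OF tendsto_rabs_zero[OF lim\<^sub>0(1)], of "1/200"] by simp
  then obtain m where m: "\<And>k. k \<ge> m \<Longrightarrow> \<bar>a\<^sub>0 k\<bar> < 1/200"
    by (auto simp: eventually_sequentially)
  define a n \<phi> where "a k = a\<^sub>0 (k + m)" and "n k = n\<^sub>0 (k + m)" and "\<phi> k = \<phi>\<^sub>0 (k + m)" for k
  have a: "\<bar>a k\<bar> < 1/200" "a k \<noteq> 0" "a k > - 1/2" "a k \<in> {- 1/2..} - {0}" for k
    using m[of "k + m"] a\<^sub>0[rule_format, of "k + m"] by (auto simp: a_def)
  have n: "real (n k) \<ge> 1" for k
    using n\<^sub>0 by (simp add: n_def Suc_le_eq)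
  have lim_a: "a \<longlonglongrightarrow> 0"
    using LIMSEQ_ignore_initial_segment[OF lim\<^sub>0(1), of m] by (simp add: a_def[abs_def])
  have lim_n: "filterlim (\<lambda>k. real (n k)) at_top sequentially"
    unfolding n_def[abs_def]
    by (intro filterlim_compose[OF filterlim_real_sequentially] filterlim_compose[OF lim\<^sub>0(2)]
        filterlim_add_const_nat_at_top)
  have del: "delaunay (a k) (x (a k)) (z (a k)) (\<tau> (a k)) (h (a k))" for k
    using delaunay a(4) by blast
  have h: "h (a k) \<le> pi / 2" "h (a k) \<ge> pi / 128" for k
    using delaunay_height_le[OF del] delaunay_height_ge[OF del] a[of k] by auto
  have "\<forall>k. \<exists>x'. (\<forall>t. (x (a k) has_real_derivative x' t) (at t)) \<and>
           (\<forall>t. (x' has_real_derivative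
                   (1 + 2 * delaunay_gamma (a k)) * x (a k) t - 2 * x (a k) t ^ 3) (at t)) \<and>
           x (a k) 0 = 1 + a k \<and> x' 0 = 0"
    using del unfolding delaunay_def by blast
  then obtain x' where x': "\<And>k t. (x (a k) has_real_derivative x' k t) (at t)"
      "\<And>k t. (x' k has_real_derivative (1 + 2 * delaunay_gamma (a k)) * x (a k) t - 2 * x (a k) t ^ 3) (at t)"
      "\<And>k. x (a k) 0 = 1 + a k" "\<And>k. x' k 0 = 0"
    by metis
  \<comment> \<open>The product \<open>\<delta> k * \<eta> k\<close> is the bending curvature
    \<open>pi / (n h)\<close>; \<open>\<eta>\<close> stays between 2 and 128 by the two height
    bounds.\<close>
  define \<delta> \<eta> where "\<delta> k = 1 / real (n k)" and "\<eta> k = pi / h (a k)" for k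
  have \<delta>: "\<delta> k > 0" for k using n[of k] by (simp add: \<delta>_def)
  have \<eta>: "2 \<le> \<eta> k" "\<eta> k \<le> 128" for k
  proof -
    have "h (a k) > 0" using h(2)[of k] pi_gt_zero by linarith
    then show "2 \<le> \<eta> k" "\<eta> k \<le> 128"
      using h[of k] by (simp_all add: \<eta>_def field_simps)
  qed
  have lim_\<delta>: "\<delta> \<longlonglongrightarrow> 0"
    unfolding \<delta>_def[abs_def] using tendsto_inverse_0_at_top[OF lim_n] by (simp add: divide_inverse)
  have loc: "bent_delaunay (a k) (\<delta> k * \<eta> k) (x (a k)) (x' k) (z (a k)) (\<phi> k)" for k
    using a[of k] \<delta>[of k] \<eta>[of k] x' del[of k] \<phi>\<^sub>0[rule_format, of "k + m"]
    by unfold_locales (auto simp: delaunay_def C2_holder_def C1_on_def \<phi>_def)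
  define p where "p = (0 :: real, pi / 2)"
  define F F\<^sub>1 F\<^sub>2 F\<^sub>1\<^sub>1 F\<^sub>1\<^sub>2 F\<^sub>2\<^sub>2 where "F k = real (n k) * \<phi> k p"
    and "F\<^sub>1 k = real (n k) * fst (grad (\<phi> k) p)" and "F\<^sub>2 k = real (n k) * snd (grad (\<phi> k) p)"
    and "F\<^sub>1\<^sub>1 k = real (n k) * fst (fst (hessian (\<phi> k) p))"
    and "F\<^sub>1\<^sub>2 k = real (n k) * snd (fst (hessian (\<phi> k) p))"
    and "F\<^sub>2\<^sub>2 k = real (n k) * snd (snd (hessian (\<phi> k) p))" for k
  \<comment> \<open>At the base point the weight function is \<open>x 0 = 1 + a\<close>, so the
    rescaled 2-jet is bounded by a quantity tending to \<open>R\<^sub>1\<close>.\<close>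
  have jet: "real (n k) * \<bar>\<phi> k p\<bar> + real (n k) * norm (grad (\<phi> k) p) + real (n k) * norm (hessian (\<phi> k) p)
      \<le> R\<^sub>1 * (1 + a k)" for k
  proof -
    have "\<tau> (a k) > 0" using del unfolding delaunay_def by blast
    then have "p \<in> period_rect (n k) (\<tau> (a k))"
      by (auto simp: p_def period_rect_def)
    then have "\<bar>\<phi> k p\<bar> + norm (grad (\<phi> k) p) + norm (hessian (\<phi> k) p) \<le> R\<^sub>1 / n k * (1 + a k)"
      using weighted_C2_norm_bound[of "period_rect (n k) (\<tau> (a k))" "x (a k)" "\<phi> k" "R\<^sub>1 / real (n k)" p]
        norm\<^sub>0[rule_format, of "k + m"] a[of k] x'(3)[of k]
      by (simp add: p_def flip: a_def n_def \<phi>_def)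
    then show ?thesis using n[of k] by (simp add: field_simps)
  qed
  have comp: "\<bar>fst u\<bar> \<le> norm u" "\<bar>snd u\<bar> \<le> norm u" for u :: "real \<times> real"
    using norm_fst_le[of "fst u" "snd u"] norm_snd_le[of "snd u" "fst u"] by simp_all
  have comp2: "\<bar>fst (fst u)\<bar> \<le> norm u" "\<bar>snd (fst u)\<bar> \<le> norm u" "\<bar>snd (snd u)\<bar> \<le> norm u"
    for u :: "(real \<times> real) \<times> (real \<times> real)"
    using norm_fst_le[of "fst u" "snd u"] norm_snd_le[of "snd u" "fst u"] comp[of "fst u"] comp[of "snd u"]
    by simp_all
  have bounds: "\<bar>F\<^sub>1 k\<bar> \<le> real (n k) * norm (grad (\<phi> k) p)" "\<bar>F\<^sub>2 k\<bar> \<le> real (n k) * norm (grad (\<phi> k) p)"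
    "\<bar>F\<^sub>1\<^sub>1 k\<bar> \<le> real (n k) * norm (hessian (\<phi> k) p)" "\<bar>F\<^sub>1\<^sub>2 k\<bar> \<le> real (n k) * norm (hessian (\<phi> k) p)"
    "\<bar>F\<^sub>2\<^sub>2 k\<bar> \<le> real (n k) * norm (hessian (\<phi> k) p)" "\<bar>F k\<bar> = real (n k) * \<bar>\<phi> k p\<bar>" for k
    by (simp_all add: F_def F\<^sub>1_def F\<^sub>2_def F\<^sub>1\<^sub>1_def F\<^sub>1\<^sub>2_def F\<^sub>2\<^sub>2_def abs_mult mult_left_mono comp comp2)
  have nonneg: "0 \<le> real (n k) * \<bar>\<phi> k p\<bar>" "0 \<le> real (n k) * norm (grad (\<phi> k) p)"
    "0 \<le> real (n k) * norm (hessian (\<phi> k) p)" for k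
    by simp_all
  \<comment> \<open>Each diagonal Hessian entry is at most the Frobenius norm, so the sum is at most
    twice the left-hand side of \<open>jet\<close>.\<close>
  have sum_bound: "F\<^sub>1\<^sub>1 k + F\<^sub>2\<^sub>2 k + 2 * F k \<le> 2 * (R\<^sub>1 * (1 + a k))" for k
    using bounds[of k] nonneg[of k] jet[of k] by linarith
  \<comment> \<open>One common bound for the jet and for \<open>\<eta>\<close>: 128 serves
    \<open>\<eta>\<close>, and \<open>R\<^sub>1 * 2\<close> serves the jet since
    \<open>a k < 1\<close>.\<close>
  have "R\<^sub>1 * (1 + a k) \<le> 128 + R\<^sub>1 * 2" for k
    using a[of k] R\<^sub>1 mult_left_mono[of "1 + a k" 2 R\<^sub>1] by linarith
  then have B: "\<bar>F k\<bar> \<le> 128 + R\<^sub>1 * 2" "\<bar>F\<^sub>1 k\<bar> \<le> 128 + R\<^sub>1 * 2" "\<bar>F\<^sub>2 k\<bar> \<le> 128 + R\<^sub>1 * 2"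
    "\<bar>F\<^sub>1\<^sub>1 k\<bar> \<le> 128 + R\<^sub>1 * 2" "\<bar>F\<^sub>1\<^sub>2 k\<bar> \<le> 128 + R\<^sub>1 * 2" "\<bar>F\<^sub>2\<^sub>2 k\<bar> \<le> 128 + R\<^sub>1 * 2" for k
    using bounds[of k] nonneg[of k] jet[of k] by (smt (verit))+
  have B\<eta>: "\<bar>\<eta> k\<bar> \<le> 128 + R\<^sub>1 * 2" for k
    using \<eta>[of k] R\<^sub>1 by linarith
  obtain r f f\<^sub>1 f\<^sub>2 f\<^sub>1\<^sub>1 f\<^sub>1\<^sub>2 f\<^sub>2\<^sub>2 \<eta>' where r: "strict_mono (r :: nat \<Rightarrow> nat)"
    and lims: "(F \<circ> r) \<longlonglongrightarrow> f" "(F\<^sub>1 \<circ> r) \<longlonglongrightarrow> f\<^sub>1" "(F\<^sub>2 \<circ> r) \<longlonglongrightarrow> f\<^sub>2"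
      "(F\<^sub>1\<^sub>1 \<circ> r) \<longlonglongrightarrow> f\<^sub>1\<^sub>1" "(F\<^sub>1\<^sub>2 \<circ> r) \<longlonglongrightarrow> f\<^sub>1\<^sub>2" "(F\<^sub>2\<^sub>2 \<circ> r) \<longlonglongrightarrow> f\<^sub>2\<^sub>2" "(\<eta> \<circ> r) \<longlonglongrightarrow> \<eta>'"
    by (rule bounded_tuple_convergent_subsequence[OF B B\<eta>])
  define s where "s k = 1 / (\<delta> k * \<eta> k) + (1 + a k - \<phi> k p)" for k
  define e where "e k = real (n k) * (H (vector [0, s k, 0]) - 1)" for k
  have surf: "bent_delaunay.surf (\<delta> k * \<eta> k) (x (a k)) (z (a k)) (\<phi> k) =
      (\<lambda>q. delaunay_torus (n k) (h (a k)) (x (a k)) (z (a k)) q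
        + \<phi> k q *\<^sub>R unit_normal (delaunay_torus (n k) (h (a k)) (x (a k)) (z (a k))) q)" for k
  proof -
    have "pi / (real (n k) * h (a k)) = \<delta> k * \<eta> k" by (simp add: \<delta>_def \<eta>_def)
    then show ?thesis
      unfolding delaunay_torus_eq_bent_tube by (simp add: fun_eq_iff bent_delaunay.surf_def[OF loc])
  qed
  have curv: "mean_curvature (bent_delaunay.surf (\<delta> k * \<eta> k) (x (a k)) (z (a k)) (\<phi> k)) (0, pi/2) = 1 + \<delta> k * e k" for k
  proof -
    have "mean_curvature (bent_delaunay.surf (\<delta> k * \<eta> k) (x (a k)) (z (a k)) (\<phi> k)) (0, pi/2)
        = H (bent_delaunay.surf (\<delta> k * \<eta> k) (x (a k)) (z (a k)) (\<phi> k) (0, pi/2))"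
      using curv\<^sub>0[rule_format, of "k + m"] unfolding surf Let_def a_def[symmetric] n_def[symmetric] \<phi>_def[symmetric] by blast
    also have "bent_delaunay.surf (\<delta> k * \<eta> k) (x (a k)) (z (a k)) (\<phi> k) (0, pi/2) = vector [0, s k, 0]"
      by (simp add: bent_delaunay.surf_base[OF loc] s_def p_def)
    finally show ?thesis using n[of k] by (simp add: e_def \<delta>_def)
  qed
  have "R\<^sub>1 < 1"
  proof -
    \<comment> \<open>The hypothesis on \<open>R\<^sub>1\<close> is used through
      \<open>pi < 3.4 \<le> 2 + sqrt 2\<close>.\<close>
    have "sqrt 2 \<ge> 1.4" by (rule real_le_rsqrt) (simp add: power2_eq_square)
    then have "pi < 2 + sqrt 2" using pi_approx(2) by simp
    then show ?thesis using R\<^sub>1 by (smt (verit) divide_less_eq_1_pos pi_gt_zero)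
  qed
  have s: "s k \<ge> 1 / 128 * real (n k)" for k
  proof -
    have "real (n k) * \<bar>\<phi> k p\<bar> \<ge> 1 * \<bar>\<phi> k p\<bar>"
      using n[of k] by (intro mult_right_mono) auto
    moreover have "R\<^sub>1 * (1 + a k) \<le> 1 * (1 + a k)"
      using \<open>R\<^sub>1 < 1\<close> a[of k] by (intro mult_right_mono) auto
    ultimately have "\<phi> k p \<le> 1 + a k"
      using jet[of k] nonneg[of k] by (smt (verit))
    moreover have "real (n k) / 128 \<le> real (n k) / \<eta> k"
      using \<eta>[of k] by (intro divide_left_mono) auto
    then have "1 / (\<delta> k * \<eta> k) \<ge> real (n k) / 128"
      by (simp add: \<delta>_def)
    ultimately show ?thesis by (simp add: s_def)
  qed
  have "e \<longlonglongrightarrow> 0"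
    unfolding e_def[abs_def] using assms(4-6) lim_n _ s by (rule curvature_decay) simp
  have scale: "\<phi> k (0, pi/2) = \<delta> k * F k" "fst (grad (\<phi> k) (0, pi/2)) = \<delta> k * F\<^sub>1 k"
    "snd (grad (\<phi> k) (0, pi/2)) = \<delta> k * F\<^sub>2 k"
    "fst (grad (\<lambda>q. fst (grad (\<phi> k) q)) (0, pi/2)) = \<delta> k * F\<^sub>1\<^sub>1 k"
    "snd (grad (\<lambda>q. fst (grad (\<phi> k) q)) (0, pi/2)) = \<delta> k * F\<^sub>1\<^sub>2 k"
    "snd (grad (\<lambda>q. snd (grad (\<phi> k) q)) (0, pi/2)) = \<delta> k * F\<^sub>2\<^sub>2 k" for k
    using n[of k] by (simp_all add: F_def F\<^sub>1_def F\<^sub>2_def F\<^sub>1\<^sub>1_def F\<^sub>1\<^sub>2_def F\<^sub>2\<^sub>2_def \<delta>_def p_def hessian_def)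
  note sub = LIMSEQ_subseq_LIMSEQ[OF _ r, unfolded comp_def]
  have "\<eta>' \<le> f\<^sub>1\<^sub>1 + f\<^sub>2\<^sub>2 + 2 * f"
    by (rule defect_limit_nonneg[OF loc sub[OF lim_a] sub[OF lim_\<delta>] lims[unfolded comp_def] sub[OF \<open>e \<longlonglongrightarrow> 0\<close>]
          \<delta> scale curv])
  \<comment> \<open>This is \<open>h \<le> pi / 2\<close> in the limit. Together with the bound
    below it yields \<open>2 \<le> 2 * R\<^sub>1\<close>, against
    \<open>R\<^sub>1 < 1\<close>.\<close>
  moreover have "2 \<le> \<eta>'"
    using lims(7) by (rule LIMSEQ_le_const) (simp add: \<eta>)
  moreover have "f\<^sub>1\<^sub>1 + f\<^sub>2\<^sub>2 + 2 * f \<le> 2 * (R\<^sub>1 * (1 + 0))"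
  proof (rule LIMSEQ_le)
    show "(\<lambda>k. F\<^sub>1\<^sub>1 (r k) + F\<^sub>2\<^sub>2 (r k) + 2 * F (r k)) \<longlonglongrightarrow> f\<^sub>1\<^sub>1 + f\<^sub>2\<^sub>2 + 2 * f"
      by (intro tendsto_intros lims[unfolded comp_def])
    show "(\<lambda>k. 2 * (R\<^sub>1 * (1 + a (r k)))) \<longlonglongrightarrow> 2 * (R\<^sub>1 * (1 + 0))"
      by (intro tendsto_intros sub lim_a)
  qed (simp add: sum_bound)
  ultimately show False using \<open>R\<^sub>1 < 1\<close> by simp
qed

end
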